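(* Let $\mathcal{A}$ be any randomized $\mathsf{LOCAL}$ algorithm that, for every $18$-regular bipartite graph $G=(V,E)$, computes a cut $E^\ast\subseteq E$ with $\mathbb{E}[|E^\ast|]\ge 0.999\cdot|E|$. Then the round complexity of $\mathcal{A}$ is $\Omega(\log n)$, where $n=|V|$.
   Context: A cut is the set of edges crossing some bipartition $V=S\cup T$. Each edge decides whether it belongs to $E^\ast$. The $\mathsf{LOCAL}$ model on the graph $G$: synchronous rounds; in each round every vertex receives messages from its neighbours, performs arbitrary local computation and sends arbitrarily large messages to its neighbours; vertices are anonymous and have independent local random bits; the exact number of vertices $n$ is known to all vertices.
   Formalization: The algorithm is required to output a cut (almost surely) on every 18-regular graph, not only bipartite ones; otherwise, since each edge decides, the 0-round algorithm outputting all of E, which is a cut of a bipartite graph, would refute the claim. *)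

theory Defs
  imports "HOL-Probability.Probability" "HOL-Library.Landau_Symbols"
begin

section \<open>Graphs and cuts\<close>

text \<open>
  Finite simple graphs on vertex sets of natural numbers. The names of the vertices are never
  available to an algorithm, so up to isomorphism this covers all finite simple graphs.
\<close>

definition simple_graph :: "nat set \<Rightarrow> nat set set \<Rightarrow> bool" where
  "simple_graph V E \<longleftrightarrow> finite V \<and> E \<subseteq> {e. e \<subseteq> V \<and> card e = 2}"

definition neighbours :: "nat set set \<Rightarrow> nat \<Rightarrow> nat set" where
  "neighbours E v = {u. {u, v} \<in> E}"

definition vertex_degree :: "nat set set \<Rightarrow> nat \<Rightarrow> nat" where
  "vertex_degree E v = card (neighbours E v)"

definition regular :: "nat \<Rightarrow> nat set \<Rightarrow> nat set set \<Rightarrow> bool" where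
  "regular d V E \<longleftrightarrow> (\<forall>v\<in>V. vertex_degree E v = d)"

definition crossing_edges :: "nat set set \<Rightarrow> nat set \<Rightarrow> nat set \<Rightarrow> nat set set" where
  "crossing_edges E S T = {e \<in> E. \<exists>s\<in>S. \<exists>t\<in>T. e = {s, t}}"

definition is_cut :: "nat set \<Rightarrow> nat set set \<Rightarrow> nat set set \<Rightarrow> bool" where
  "is_cut V E F \<longleftrightarrow> (\<exists>S T. S \<union> T = V \<and> S \<inter> T = {} \<and> F = crossing_edges E S T)"

definition bipartite :: "nat set \<Rightarrow> nat set set \<Rightarrow> bool" where
  "bipartite V E \<longleftrightarrow>
     (\<exists>S T. S \<union> T = V \<and> S \<inter> T = {} \<and> (\<forall>e\<in>E. \<exists>s\<in>S. \<exists>t\<in>T. e = {s, t}))"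

section \<open>The anonymous randomized LOCAL model\<close>

text \<open>
  Vertices address their neighbours through local ports: \<open>P v i\<close> is the neighbour of \<open>v\<close> behind
  its port \<open>i < vertex_degree E v\<close>. Port numbers are arbitrary and carry no global information; an
  algorithm that broadcasts and treats its incoming messages as a multiset is the special case
  of an algorithm ignoring them.
\<close>

definition port_numbering :: "nat set \<Rightarrow> nat set set \<Rightarrow> (nat \<Rightarrow> nat \<Rightarrow> nat) \<Rightarrow> bool" where
  "port_numbering V E P \<longleftrightarrow> (\<forall>v\<in>V. bij_betw (P v) {..<vertex_degree E v} (neighbours E v))"

definition port_to :: "nat set set \<Rightarrow> (nat \<Rightarrow> nat \<Rightarrow> nat) \<Rightarrow> nat \<Rightarrow> nat \<Rightarrow> nat" where
  "port_to E P u v = inv_into {..<vertex_degree E u} (P u) v"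

text \<open>
  \<open>rounds A n\<close> is the round complexity on \<open>n\<close>-vertex graphs: since all vertices know \<open>n\<close>, an
  algorithm whose vertices stop at different times, the last one after at most \<open>T\<close> rounds, can
  be run for exactly \<open>T\<close> rounds. The initial state depends on the number of vertices, the
  degree, and an infinite sequence of random bits, and may retain all of these. States and
  messages are of arbitrary type, so neither local computation nor message size is bounded.
  An edge decides from the final states of its two endpoints and the ports leading to it.
\<close>

record ('s, 'm) local_algorithm =
  rounds :: "nat \<Rightarrow> nat"
  init :: "nat \<Rightarrow> nat \<Rightarrow> (nat \<Rightarrow> bool) \<Rightarrow> 's"
  send :: "'s \<Rightarrow> nat \<Rightarrow> 'm"
  receive :: "'s \<Rightarrow> 'm list \<Rightarrow> 's"
  decide :: "'s \<times> nat \<Rightarrow> 's \<times> nat \<Rightarrow> bool"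

fun local_state :: "('s, 'm) local_algorithm \<Rightarrow> nat set \<Rightarrow> nat set set \<Rightarrow> (nat \<Rightarrow> nat \<Rightarrow> nat) \<Rightarrow>
    (nat \<Rightarrow> nat \<Rightarrow> bool) \<Rightarrow> nat \<Rightarrow> nat \<Rightarrow> 's" where
  "local_state A V E P \<omega> 0 v = init A (card V) (vertex_degree E v) (\<omega> v)"
| "local_state A V E P \<omega> (Suc t) v =
     receive A (local_state A V E P \<omega> t v)
       (map (\<lambda>i. send A (local_state A V E P \<omega> t (P v i)) (port_to E P (P v i) v))
         [0..<vertex_degree E v])"

text \<open>
  An edge has no orientation: it belongs to the output as soon as \<open>decide\<close> holds for one of the
  two orders of its endpoints. For symmetric \<open>decide\<close> the order is irrelevant.
\<close>

definition output_edges :: "('s, 'm) local_algorithm \<Rightarrow> nat set \<Rightarrow> nat set set \<Rightarrow>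
    (nat \<Rightarrow> nat \<Rightarrow> nat) \<Rightarrow> (nat \<Rightarrow> nat \<Rightarrow> bool) \<Rightarrow> nat set set" where
  "output_edges A V E P \<omega> =
     (let st = local_state A V E P \<omega> (rounds A (card V))
      in {{u, v} | u v. {u, v} \<in> E \<and> decide A (st u, port_to E P u v) (st v, port_to E P v u)})"

definition random_bits :: "nat set \<Rightarrow> (nat \<Rightarrow> nat \<Rightarrow> bool) measure" where
  "random_bits V = (\<Pi>\<^sub>M v\<in>V. \<Pi>\<^sub>M i\<in>(UNIV :: nat set). measure_pmf (bernoulli_pmf (1/2)))"

text \<open>
  The first conjunct makes the probability that an edge joins the output meaningful; it is
  automatic if each vertex only uses finitely many of its bits.
\<close>

definition computes_cut :: "('s, 'm) local_algorithm \<Rightarrow> nat set \<Rightarrow> nat set set \<Rightarrow>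
    (nat \<Rightarrow> nat \<Rightarrow> nat) \<Rightarrow> bool" where
  "computes_cut A V E P \<longleftrightarrow>
     (\<forall>e\<in>E. {\<omega> \<in> space (random_bits V). e \<in> output_edges A V E P \<omega>} \<in> sets (random_bits V)) \<and>
     (AE \<omega> in random_bits V. is_cut V E (output_edges A V E P \<omega>))"

definition expected_output_size :: "('s, 'm) local_algorithm \<Rightarrow> nat set \<Rightarrow> nat set set \<Rightarrow>
    (nat \<Rightarrow> nat \<Rightarrow> nat) \<Rightarrow> real" where
  "expected_output_size A V E P =
     (\<integral>\<omega>. real (card (output_edges A V E P \<omega>)) \<partial>random_bits V)"

text \<open>
  The numbers of vertices of \<open>d\<close>-regular bipartite graphs; asymptotic statements in the number
  of vertices range over these, since round complexity is meaningless for other sizes.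
\<close>

definition regular_bipartite_sizes :: "nat \<Rightarrow> nat set" where
  "regular_bipartite_sizes d =
     {card V | V E. simple_graph V E \<and> regular d V E \<and> bipartite V E}"

end

(*
  Compare two graphs on the same number n of vertices: two disjoint copies of an 18-regular base
  graph X, and the bipartite double cover of X. Around a vertex of X without short odd closed walks
  the two graphs look the same, so an edge there joins the output with the same probability in both.
  If almost all vertices are of this kind, a cut of density 0.999 on the double cover yields a cut of
  almost the same density on X, which is impossible if X is far from bipartite.

  X is a Margulis graph: 2-shears with translations acting on (Z/m)^2, times a cyclic coordinate, plus
  a small circulant graph that corrects the number of vertices. It is far from bipartite by the
  Fourier argument of Gabber-Galil and Jimbo-Maruoka. An odd word of length R in the shears differs
  from the identity modulo 4 and has entries of size at most 3^R, so it fixes at most m 3^R points of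
  (Z/m)^2; hence m = exp(O(R)) suffices for few short odd closed walks.
*)

theory Submission
  imports Defs
begin

section \<open>Fourier analysis on the discrete torus\<close>

text \<open>All vertices know n, so X itself is not compared with its double cover; two copies of X
  have the size of the cover. They are not bipartite, hence the size guarantee says nothing about
  them. What is used there is that the output is still almost surely a cut, which \<open>cut\<close>
  demands on every 18-regular graph. Only odd closed walks can be rare. Even ones are everywhere:
  the ports 0, 10, 2, 10 of the Margulis graph lead back to every starting vertex, so balls are far
  from trees. Lifting a ball to the double cover only requires that the parity of walks be well
  defined in it, and this parity is what the shears show modulo 4. The budget of densities is 0.999
  - 0.002 > 0.991. The spectral bound is applied to ports 0, 1, 5 and 6 only; counting the other
  fourteen ports of each vertex as cut still leaves density 713/720, which is below 0.991.\<close>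

lemma sum_periodic_shift:
  fixes g :: "int \<Rightarrow> 'a::comm_monoid_add"
  assumes "m > 0" and per: "\<And>x. g (x mod m) = g x"
  shows "(\<Sum>x\<in>{0..<m}. g (x + c)) = (\<Sum>x\<in>{0..<m}. g x)"
proof (rule sum.reindex_bij_witness[of _ "\<lambda>x. (x - c) mod m" "\<lambda>x. (x + c) mod m"])
  fix x assume "x \<in> {0..<m}"
  then show "((x + c) mod m - c) mod m = x" "((x - c) mod m + c) mod m = x"
    by (simp_all add: mod_simps)
qed (use assms in auto)

definition ech :: "int \<Rightarrow> int \<Rightarrow> complex" where
  "ech m k = cis (2 * pi * of_int k / of_int m)"

lemma ech_add: "ech m (j + k) = ech m j * ech m k"
  by (simp add: ech_def cis_mult ring_distribs add_divide_distrib)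

lemma ech_0 [simp]: "ech m 0 = 1"
  by (simp add: ech_def)

lemma cnj_ech: "cnj (ech m k) = ech m (- k)"
  by (simp add: ech_def cis_cnj)

lemma ech_mult_self:
  assumes "m > 0" shows "ech m (m * j) = 1"
proof -
  have "2 * pi * of_int (m * j) / of_int m = 2 * pi * (of_int j :: real)"
    using assms by simp
  then show ?thesis unfolding ech_def by (simp only: cis_multiple_2pi Ints_of_int)
qed

lemma ech_cong:
  assumes "m > 0" "j mod m = k mod m" shows "ech m j = ech m k"
proof -
  have "m dvd j - k" using assms(2) by (simp add: mod_eq_dvd_iff)
  then obtain l where "j = k + m * l" by (metis dvdE add_diff_cancel_left' diff_add_cancel add.commute)
  then show ?thesis by (simp add: ech_add ech_mult_self assms(1))
qed

lemma ech_eq_1_imp_dvd: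
  assumes "m > 0" "ech m k = 1" shows "m dvd k"
proof -
  have "exp (\<i> * of_real (2 * pi * of_int k / of_int m)) = 1"
    using assms(2) by (simp add: ech_def cis_conv_exp)
  then obtain n :: int where "2 * pi * of_int k / of_int m = of_int (2 * n) * pi"
    by (auto simp: exp_eq_1)
  then have "(of_int k :: real) = of_int (n * m)"
    using assms(1) by (simp add: field_simps)
  then have "k = n * m" by (simp only: of_int_eq_iff)
  then show ?thesis by simp
qed

text \<open>With x = pi k / m this is 1 + exp(2 i x) = exp(i x) * 2 cos x. The factor
  \<open>1 + ech m k\<close> is what adding a function and its translate by one does at frequency k;
  that its modulus drops below 2 away from frequency 0 is the source of the spectral gap.\<close>

lemma norm_1_plus_ech: "norm (1 + ech m k) = 2 * \<bar>cos (pi * of_int k / of_int m)\<bar>"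
proof -
  define x where "x = pi * of_int k / of_int m"
  have "1 + ech m k = cis x * of_real (2 * cos x)"
    by (simp add: ech_def x_def complex_eq_iff cos_double_cos sin_double power2_eq_square
        flip: mult.assoc)
       (simp add: mult.assoc cos_double_cos sin_double power2_eq_square flip: times_divide_eq_right)
  then show ?thesis by (simp add: norm_mult x_def)
qed

text \<open>Orthogonality of characters: shifting s by 1 permutes the range and multiplies the sum
  by \<open>ech m k\<close>, which is 1 only if m divides k.\<close>

lemma sum_ech:
  assumes "m > 0"
  shows "(\<Sum>s\<in>{0..<m}. ech m (s * k)) = (if m dvd k then of_int m else 0)"
proof (cases "m dvd k")
  case True
  then have "ech m (s * k) = 1" for s
    using ech_mult_self[OF assms, of "s * (k div m)"]
    by (metis dvd_div_mult_self mult.assoc mult.commute)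
  then show ?thesis using True assms by simp
next
  case False
  let ?S = "\<Sum>s\<in>{0..<m}. ech m (s * k)"
  have "?S = (\<Sum>s\<in>{0..<m}. ech m ((s + 1) * k))"
    by (rule sum_periodic_shift[symmetric, OF assms])
       (intro ech_cong assms, simp add: mod_simps)
  also have "\<dots> = ?S * ech m k"
    by (simp add: ring_distribs ech_add sum_distrib_right)
  finally have "?S * (ech m k - 1) = 0" by (simp add: algebra_simps)
  then show ?thesis using False ech_eq_1_imp_dvd[OF assms, of k] by auto
qed

lemma parseval_1d:
  fixes f g :: "int \<Rightarrow> complex"
  assumes "m > 0"
  shows "(\<Sum>s\<in>{0..<m}. cnj (\<Sum>x\<in>{0..<m}. f x * ech m (s * x)) * (\<Sum>x\<in>{0..<m}. g x * ech m (s * x)))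
    = of_int m * (\<Sum>x\<in>{0..<m}. cnj (f x) * g x)"
proof -
  have split: "ech m (s * (y - x)) = ech m (- (s * x)) * ech m (s * y)" for s x y
    by (simp add: algebra_simps flip: ech_add)
  have "(\<Sum>s\<in>{0..<m}. cnj (\<Sum>x\<in>{0..<m}. f x * ech m (s * x)) * (\<Sum>x\<in>{0..<m}. g x * ech m (s * x)))
    = (\<Sum>s\<in>{0..<m}. \<Sum>x\<in>{0..<m}. \<Sum>y\<in>{0..<m}. cnj (f x) * g y * ech m (s * (y - x)))"
    unfolding cnj_sum sum_product
    by (intro sum.cong refl) (simp add: split cnj_ech)
  also have "\<dots> = (\<Sum>x\<in>{0..<m}. \<Sum>y\<in>{0..<m}. \<Sum>s\<in>{0..<m}. cnj (f x) * g y * ech m (s * (y - x)))"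
    by (subst sum.swap, rule sum.cong[OF refl], rule sum.swap)
  also have "\<dots> = (\<Sum>x\<in>{0..<m}. \<Sum>y\<in>{0..<m}. if x = y then of_int m * (cnj (f x) * g y) else 0)"
  proof (intro sum.cong refl)
    fix x y assume "x \<in> {0..<m}" "y \<in> {0..<m}"
    then have "m dvd y - x \<longleftrightarrow> x = y"
      by (metis mod_eq_dvd_iff atLeastLessThan_iff mod_pos_pos_trivial)
    then show "(\<Sum>s\<in>{0..<m}. cnj (f x) * g y * ech m (s * (y - x))) =
        (if x = y then of_int m * (cnj (f x) * g y) else 0)"
      by (simp add: sum_ech[OF assms] flip: sum_distrib_left)
  qed
  also have "\<dots> = of_int m * (\<Sum>x\<in>{0..<m}. cnj (f x) * g x)"
    by (simp add: sum_distrib_left)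
  finally show ?thesis .
qed

text \<open>Functions on the torus are total functions on \<open>int\<close>; periodicity is assumed
  where arguments leave \<open>{0..<m}\<close>.\<close>

definition dft :: "int \<Rightarrow> (int \<Rightarrow> int \<Rightarrow> real) \<Rightarrow> int \<Rightarrow> int \<Rightarrow> complex" where
  "dft m f s t = (\<Sum>x\<in>{0..<m}. \<Sum>y\<in>{0..<m}. of_real (f x y) * ech m (s * x + t * y))"

lemma parseval:
  assumes "m > 0"
  shows "(\<Sum>s\<in>{0..<m}. \<Sum>t\<in>{0..<m}. cnj (dft m f s t) * dft m g s t)
    = of_int (m\<^sup>2) * of_real (\<Sum>x\<in>{0..<m}. \<Sum>y\<in>{0..<m}. f x y * g x y)"
proof -
  define h where "h f x t = (\<Sum>y\<in>{0..<m}. of_real (f x y) * ech m (t * y))" for f :: "int \<Rightarrow> int \<Rightarrow> real" and x t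
  have dft: "dft m f s t = (\<Sum>x\<in>{0..<m}. h f x t * ech m (s * x))" for f s t
    by (simp add: dft_def h_def sum_distrib_left sum_distrib_right ech_add mult_ac)
  have "(\<Sum>s\<in>{0..<m}. \<Sum>t\<in>{0..<m}. cnj (dft m f s t) * dft m g s t)
      = (\<Sum>t\<in>{0..<m}. of_int m * (\<Sum>x\<in>{0..<m}. cnj (h f x t) * h g x t))"
    by (subst sum.swap) (simp only: dft parseval_1d[OF assms])
  also have "\<dots> = of_int m * (\<Sum>x\<in>{0..<m}. \<Sum>t\<in>{0..<m}. cnj (h f x t) * h g x t)"
    by (subst sum.swap) (simp add: sum_distrib_left)
  also have "\<dots> = of_int m * (\<Sum>x\<in>{0..<m}. of_int m * (\<Sum>y\<in>{0..<m}. of_real (f x y * g x y)))"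
    by (simp only: h_def parseval_1d[OF assms] complex_cnj_complex_of_real of_real_mult)
  finally show ?thesis by (simp add: sum_distrib_left power2_eq_square mult_ac)
qed

lemma dft_cong:
  assumes "m > 0" "s mod m = s' mod m" "t mod m = t' mod m"
  shows "dft m f s t = dft m f s' t'"
proof -
  have "(s * x + t * y) mod m = (s' * x + t' * y) mod m" for x y
    using assms(2,3) by (metis mod_add_cong mod_mult_cong)
  then have "ech m (s * x + t * y) = ech m (s' * x + t' * y)" for x y
    by (rule ech_cong[OF assms(1)])
  then show ?thesis by (simp add: dft_def)
qed

lemma dft_swap: "dft m (\<lambda>x y. f y x) s t = dft m f t s"
  unfolding dft_def by (subst sum.swap) (simp add: add.commute)

text \<open>Substitute u = x + 2 y + k: then s x + t y = s u + (t - 2 s) y - s k. So the shear acts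
  on frequencies by its inverse transpose, which again fixes one coordinate, and the translation
  contributes a phase.\<close>

lemma dft_shear:
  assumes "m > 0" and per: "\<And>x y. f (x mod m) y = f x y"
  shows "dft m (\<lambda>x y. f (x + 2 * y + k) y) s t = ech m (- (s * k)) * dft m f s (t - 2 * s)"
proof -
  have "(\<Sum>x\<in>{0..<m}. of_real (f (x + 2 * y + k) y) * ech m (s * x + t * y))
     = ech m (- (s * k)) * (\<Sum>x\<in>{0..<m}. of_real (f x y) * ech m (s * x + (t - 2 * s) * y))" for y
  proof -
    let ?h = "\<lambda>u. of_real (f u y) * ech m (s * u + (t - 2 * s) * y - s * k)"
    have "?h (x mod m) = ?h x" for x
    proof -
      have "ech m (s * (x mod m) + (t - 2 * s) * y - s * k) = ech m (s * x + (t - 2 * s) * y - s * k)"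
        by (intro ech_cong[OF assms(1)] mod_diff_cong mod_add_cong) (simp_all add: mod_simps)
      then show ?thesis by (simp add: per)
    qed
    then have "(\<Sum>x\<in>{0..<m}. ?h (x + (2 * y + k))) = (\<Sum>x\<in>{0..<m}. ?h x)"
      by (rule sum_periodic_shift[OF assms(1)])
    moreover have "?h (x + (2 * y + k)) = of_real (f (x + 2 * y + k) y) * ech m (s * x + t * y)" for x
      by (simp add: algebra_simps)
    moreover have "?h x = ech m (- (s * k)) * (of_real (f x y) * ech m (s * x + (t - 2 * s) * y))" for x
      by (simp add: diff_conv_add_uminus ech_add del: add_uminus_conv_diff)
    ultimately show ?thesis by (simp add: sum_distrib_left)
  qed
  then show ?thesis
    unfolding dft_def by (subst (1 2) sum.swap) (simp add: sum_distrib_left)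
qed

section \<open>The spectral estimate of Gabber and Galil\<close>

definition circ_abs :: "int \<Rightarrow> int \<Rightarrow> int" where
  "circ_abs m k = min (k mod m) (m - k mod m)"

lemma circ_abs_cong: "j mod m = k mod m \<Longrightarrow> circ_abs m j = circ_abs m k"
  by (simp add: circ_abs_def)

lemma circ_abs_minus:
  assumes "m > 0" shows "circ_abs m (- k) = circ_abs m k"
  using assms by (auto simp: circ_abs_def zmod_zminus1_eq_if min_def)

lemma circ_abs_small:
  assumes "m > 0" "\<bar>k\<bar> \<le> m" shows "circ_abs m k = min \<bar>k\<bar> (m - \<bar>k\<bar>)"
proof -
  have "circ_abs m \<bar>k\<bar> = min \<bar>k\<bar> (m - \<bar>k\<bar>)"
    using assms by (cases "\<bar>k\<bar> = m") (auto simp: circ_abs_def)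
  then show ?thesis using circ_abs_minus[OF assms(1)] by (cases "k \<ge> 0") (metis abs_of_nonneg abs_of_neg not_le)+
qed

lemma circ_abs_bounds:
  assumes "m > 0" shows "0 \<le> circ_abs m k" "2 * circ_abs m k \<le> m"
  using assms pos_mod_bound[of m k] by (auto simp: circ_abs_def min_def pos_mod_sign less_imp_le)

lemma circ_abs_eq_0_iff:
  assumes "m > 0" shows "circ_abs m k = 0 \<longleftrightarrow> m dvd k"
  using pos_mod_bound[OF assms, of k] by (auto simp: circ_abs_def min_def dvd_eq_mod_eq_0)

lemma circ_abs_cases:
  assumes "m > 0"
  obtains "k mod m = circ_abs m k mod m" | "k mod m = - circ_abs m k mod m"
proof (cases "circ_abs m k = k mod m")
  case False
  then have "circ_abs m k = m - k mod m" by (simp add: circ_abs_def min_def split: if_splits)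
  then have "- circ_abs m k mod m = k mod m" by (simp add: mod_simps)
  then show ?thesis using that(2) by simp
qed (use that in simp)

text \<open>The weights of the arithmetic-geometric mean inequality in the spectral estimate of
  Gabber and Galil, in the form given by Jimbo and Maruoka.\<close>

definition ggw :: "int \<Rightarrow> int \<Rightarrow> real" where
  "ggw u v = (if u < v then 4/5 else if v < u then 5/4 else 1)"

lemma ggw_le: "ggw u v \<le> 5/4" and ggw_pos: "ggw u v > 0"
  by (auto simp: ggw_def)

text \<open>The two weights are reciprocal, so this is (c x - y)^2 / c >= 0 with c one of them. In
  the application u and v are the distances to 0 of a frequency coordinate before and after a shear;
  the farther one gets 5/4, the closer one 4/5.\<close>

lemma ggw_mean:
  fixes x y :: real
  shows "2 * x * y \<le> ggw u v * x\<^sup>2 + ggw v u * y\<^sup>2"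
proof -
  have "2 * x * y \<le> c * x\<^sup>2 + d * y\<^sup>2" if "c * d = 1" "c > 0" for c d :: real
  proof -
    have "0 \<le> (c * x - y)\<^sup>2 / c" using that by simp
    also have "\<dots> = c * x\<^sup>2 - 2 * x * y + (1 / c) * y\<^sup>2"
      using that by (simp add: power2_eq_square field_simps)
    also have "1 / c = d" using that by (simp add: field_simps)
    finally show ?thesis by simp
  qed
  from this[of "ggw u v" "ggw v u"] show ?thesis by (auto simp: ggw_def)
qed

text \<open>Half the modulus of the multiplier \<open>1 + ech m k\<close>.\<close>

definition abs_cos :: "int \<Rightarrow> int \<Rightarrow> real" where
  "abs_cos m k = \<bar>cos (pi * of_int k / of_int m)\<bar>"

lemma abs_cos_circ_abs:
  assumes "m > 0" shows "abs_cos m k = cos (pi * of_int (circ_abs m k) / of_int m)"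
proof -
  have norm: "2 * abs_cos m j = norm (1 + ech m j)" for j
    by (simp add: norm_1_plus_ech abs_cos_def)
  have "abs_cos m k = abs_cos m (circ_abs m k)"
    using circ_abs_cases[OF assms, of k]
  proof cases
    case 1
    then show ?thesis using norm[of k] norm[of "circ_abs m k"] ech_cong[OF assms 1] by simp
  next
    case 2
    then have "abs_cos m k = abs_cos m (- circ_abs m k)"
      using norm[of k] norm[of "- circ_abs m k"] ech_cong[OF assms 2] by simp
    then show ?thesis by (simp add: abs_cos_def)
  qed
  moreover have "cos (pi * of_int (circ_abs m k) / of_int m) \<ge> 0"
  proof (rule cos_ge_zero)
    have "0 \<le> pi * of_int (circ_abs m k) / of_int m"
      using circ_abs_bounds[OF assms, of k] assms by simp
    then show "- (pi / 2) \<le> pi * of_int (circ_abs m k) / of_int m"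
      by (rule order_trans[rotated]) simp
    show "pi * of_int (circ_abs m k) / of_int m \<le> pi / 2"
      using circ_abs_bounds[OF assms, of k] assms by (simp add: field_simps)
  qed
  ultimately show ?thesis by (simp add: abs_cos_def)
qed

text \<open>The hypothesis says that the two angles, each at most pi/2, add up to at least pi/2.
  Hence cos b <= sin a, and cos a + sin a <= sqrt 2.\<close>

lemma abs_cos_sum_le:
  assumes "m > 0" "m \<le> 2 * (circ_abs m s + circ_abs m t)"
  shows "abs_cos m s + abs_cos m t \<le> sqrt 2"
proof -
  define a b :: real where "a = pi * of_int (circ_abs m s) / of_int m"
    and "b = pi * of_int (circ_abs m t) / of_int m"
  have "pi * of_int m \<le> pi * of_int (2 * (circ_abs m s + circ_abs m t))"
    using assms by (intro mult_left_mono) (simp_all only: of_int_le_iff pi_ge_zero)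
  then have "a + b \<ge> pi / 2"
    using assms(1) by (simp add: a_def b_def field_simps)
  moreover have "0 \<le> a" "a \<le> pi / 2" "b \<le> pi / 2"
    using circ_abs_bounds[OF assms(1), of s] circ_abs_bounds[OF assms(1), of t] assms(1)
    by (auto simp: a_def b_def field_simps)
  ultimately have "cos b \<le> cos (pi / 2 - a)"
    using cos_monotone_0_pi_le[of "pi / 2 - a" b] by simp
  also have "\<dots> = sin a" by (simp add: cos_diff)
  finally have "cos a + cos b \<le> cos a + sin a" by simp
  also have "\<dots> \<le> sqrt 2"
  proof (rule real_le_rsqrt)
    have "(cos a + sin a)\<^sup>2 + (cos a - sin a)\<^sup>2 = 2 * ((sin a)\<^sup>2 + (cos a)\<^sup>2)"
      by (simp add: power2_eq_square algebra_simps)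
    then have "(cos a + sin a)\<^sup>2 + (cos a - sin a)\<^sup>2 = 2" by simp
    then show "(cos a + sin a)\<^sup>2 \<le> 2" using zero_le_power2[of "cos a - sin a"] by linarith
  qed
  finally show ?thesis by (simp add: abs_cos_circ_abs[OF assms(1)] a_def b_def)
qed

definition ggw_pair :: "int \<Rightarrow> int \<Rightarrow> int \<Rightarrow> real" where
  "ggw_pair m s t = ggw (circ_abs m t) (circ_abs m (t - 2 * s)) + ggw (circ_abs m t) (circ_abs m (t + 2 * s))"

text \<open>A sign change of s or of t merely swaps the two summands, so a frequency may be moved to
  the quadrant where both coordinates lie between 0 and m/2.\<close>

lemma ggw_pair_circ_abs:
  assumes "m > 0"
  shows "ggw_pair m s t = ggw_pair m (circ_abs m s) (circ_abs m t)"
proof -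
  have cong: "ggw_pair m s t = ggw_pair m s' t'" if "s mod m = s' mod m" "t mod m = t' mod m" for s t s' t'
  proof -
    have "(t - 2 * s) mod m = (t' - 2 * s') mod m" "(t + 2 * s) mod m = (t' + 2 * s') mod m"
      using that by (metis mod_diff_cong mod_add_cong mod_mult_right_eq)+
    then show ?thesis using that circ_abs_cong unfolding ggw_pair_def by metis
  qed
  have "circ_abs m (- t - 2 * s) = circ_abs m (t + 2 * s)"
    "circ_abs m (- t + 2 * s) = circ_abs m (t - 2 * s)" for s t
    using circ_abs_minus[OF assms, of "t + 2 * s"] circ_abs_minus[OF assms, of "t - 2 * s"]
    by (simp_all add: algebra_simps)
  then have neg: "ggw_pair m (- s) t = ggw_pair m s t" "ggw_pair m s (- t) = ggw_pair m s t" for s t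
    by (simp_all add: ggw_pair_def circ_abs_minus[OF assms])
  show ?thesis
    by (rule circ_abs_cases[OF assms, of s]; rule circ_abs_cases[OF assms, of t])
       (metis cong neg)+
qed

text \<open>For 0 < u < v, of the four moves only that of v to v - 2 u brings the moved coordinate
  closer to 0; the other three take it farther away. This gives 5/4 + 3 * 4/5 = 73/20. For u = 0 two
  moves are trivial, and 1 + 1 + 2 * 4/5 is smaller.\<close>

lemma ggw_pair_diamond:
  fixes u v m :: int
  assumes "0 \<le> u" "u < v" "2 * (u + v) < m"
  shows "ggw_pair m u v + ggw_pair m v u \<le> 73/20"
proof -
  have "2 * u + 2 * v < m" using assms by simp
  then have m: "m > 0" using assms(1,2) by linarith
  have self: "circ_abs m u = u" "circ_abs m v = v"
    using assms circ_abs_small[OF m, of u] circ_abs_small[OF m, of v] by auto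
  have "circ_abs m (u - 2 * v) = min (2 * v - u) (m - (2 * v - u))"
    "circ_abs m (u + 2 * v) = min (u + 2 * v) (m - (u + 2 * v))"
    "circ_abs m (v + 2 * u) = min (v + 2 * u) (m - (v + 2 * u))"
    using assms circ_abs_small[OF m, of "u - 2 * v"] circ_abs_small[OF m, of "u + 2 * v"]
      circ_abs_small[OF m, of "v + 2 * u"] by simp_all
  then have outer: "u < circ_abs m (u - 2 * v)" "u < circ_abs m (u + 2 * v)"
    and inner: "u > 0 \<Longrightarrow> v < circ_abs m (v + 2 * u)"
    using assms by simp_all
  show ?thesis
  proof (cases "u = 0")
    case True
    then show ?thesis using outer self by (simp add: ggw_pair_def ggw_def)
  next
    case False
    have "circ_abs m (v - 2 * u) < v"
    proof -
      have "\<bar>v - 2 * u\<bar> < v" "\<bar>v - 2 * u\<bar> \<le> m" using assms False by auto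
      then show ?thesis using circ_abs_small[OF m, of "v - 2 * u"] by simp
    qed
    then show ?thesis using outer inner self assms(1) False by (simp add: ggw_pair_def ggw_def)
  qed
qed

text \<open>Two regimes. In the diamond 2 (u + v) < m wrapping around does not spoil the comparison
  of distances, so the weights are good and the cosines are bounded by 1. Outside it the weights are
  bounded by 5/4 each and the damping by the cosines wins.\<close>

lemma ggw_pointwise:
  assumes m: "m > 0" and nz: "\<not> (m dvd s \<and> m dvd t)"
  shows "abs_cos m s * ggw_pair m s t + abs_cos m t * ggw_pair m t s \<le> 73/20"
proof -
  define u v where "u = circ_abs m s" and "v = circ_abs m t"
  have uv: "0 \<le> u" "2 * u \<le> m" "0 \<le> v" "2 * v \<le> m" "u \<noteq> 0 \<or> v \<noteq> 0"
    using circ_abs_bounds[OF m] nz by (auto simp: u_def v_def circ_abs_eq_0_iff[OF m])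
  have bounds: "0 \<le> abs_cos m k" "abs_cos m k \<le> 1" for k by (simp_all add: abs_cos_def)
  have pair: "0 \<le> ggw_pair m j k" "ggw_pair m j k \<le> 5/2" for j k
    unfolding ggw_pair_def
    using ggw_le[of "circ_abs m k" "circ_abs m (k - 2 * j)"] ggw_le[of "circ_abs m k" "circ_abs m (k + 2 * j)"]
      ggw_pos[of "circ_abs m k" "circ_abs m (k - 2 * j)"] ggw_pos[of "circ_abs m k" "circ_abs m (k + 2 * j)"]
    by linarith+
  show ?thesis
  proof (cases "2 * (u + v) < m")
    case True
    have "ggw_pair m u v + ggw_pair m v u \<le> 73/20"
    proof (cases u v rule: linorder_cases)
      case less
      then show ?thesis using ggw_pair_diamond[of u v m] uv True by simp
    next
      case equal
      have "circ_abs m u = u" "circ_abs m (- u) = u" "circ_abs m (3 * u) > u"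
        using circ_abs_small[OF m, of u] circ_abs_small[OF m, of "- u"] circ_abs_small[OF m, of "3 * u"]
          uv True equal by auto
      then show ?thesis unfolding equal[symmetric] by (simp add: ggw_pair_def ggw_def)
    next
      case greater
      then show ?thesis using ggw_pair_diamond[of v u m] uv True by simp
    qed
    moreover have "ggw_pair m s t = ggw_pair m u v" "ggw_pair m t s = ggw_pair m v u"
      using ggw_pair_circ_abs[OF m] by (simp_all add: u_def v_def)
    moreover have "abs_cos m s * ggw_pair m s t \<le> 1 * ggw_pair m s t"
      "abs_cos m t * ggw_pair m t s \<le> 1 * ggw_pair m t s"
      using bounds pair by (intro mult_right_mono; simp)+
    ultimately show ?thesis by linarith
  next
    case False
    have "abs_cos m s * ggw_pair m s t + abs_cos m t * ggw_pair m t s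
        \<le> abs_cos m s * (5/2) + abs_cos m t * (5/2)"
      using bounds pair by (intro add_mono mult_left_mono)
    also have "\<dots> = (abs_cos m s + abs_cos m t) * (5/2)" by simp
    also have "\<dots> \<le> sqrt 2 * (5/2)"
      using abs_cos_sum_le[OF m, of s t] False by (simp add: u_def v_def)
    \<comment> \<open>1.46 * 5/2 is exactly 73/20, the bound of the other case.\<close>
    also have "sqrt 2 \<le> 1.46" by (rule real_le_lsqrt) (simp_all add: power2_eq_square)
    finally show ?thesis by simp
  qed
qed

text \<open>The shear \<open>(s, t) \<mapsto> (s, t - 2 * s)\<close> fixes \<open>abs_cos m s\<close>, so reindexing the second half of the
  weighted squares produces the weight of the inverse shear, whence the two summands of \<open>ggw_pair\<close>.\<close>

lemma shear_form_le:
  fixes A :: "int \<Rightarrow> int \<Rightarrow> int \<Rightarrow> real"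
  assumes m: "m > 0" and q: "q > 0"
    and per: "\<And>a s t. A a s (t mod m) = A a s t" "\<And>a s t. A (a mod q) s t = A a s t"
  shows "(\<Sum>s\<in>{0..<m}. \<Sum>t\<in>{0..<m}. \<Sum>a\<in>{0..<q}. 2 * abs_cos m s * A a s t * A (a + c) s (t - 2 * s))
     \<le> (\<Sum>s\<in>{0..<m}. \<Sum>t\<in>{0..<m}. abs_cos m s * ggw_pair m s t * (\<Sum>a\<in>{0..<q}. (A a s t)\<^sup>2))"
proof (rule sum_mono)
  fix s
  let ?g = "\<lambda>j k. ggw (circ_abs m j) (circ_abs m k)"
  define W where "W t = (\<Sum>a\<in>{0..<q}. (A a s t)\<^sup>2)" for t
  have W: "W (t mod m) = W t" for t by (simp add: W_def per)
  have shift: "(\<Sum>a\<in>{0..<q}. (A (a + c) s t)\<^sup>2) = W t" for t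
    unfolding W_def by (rule sum_periodic_shift[OF q]) (simp add: per)
  have "(\<Sum>a\<in>{0..<q}. 2 * abs_cos m s * A a s t * A (a + c) s (t - 2 * s))
      \<le> abs_cos m s * (?g t (t - 2 * s) * W t + ?g (t - 2 * s) t * W (t - 2 * s))" for t
  proof -
    have "(\<Sum>a\<in>{0..<q}. 2 * abs_cos m s * A a s t * A (a + c) s (t - 2 * s)) =
      abs_cos m s * (\<Sum>a\<in>{0..<q}. 2 * A a s t * A (a + c) s (t - 2 * s))"
      by (simp add: sum_distrib_left mult_ac)
    also have "\<dots> \<le> abs_cos m s * (\<Sum>a\<in>{0..<q}. ?g t (t - 2 * s) * (A a s t)\<^sup>2
        + ?g (t - 2 * s) t * (A (a + c) s (t - 2 * s))\<^sup>2)"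
      by (intro mult_left_mono sum_mono ggw_mean) (simp add: abs_cos_def)
    finally have "(\<Sum>a\<in>{0..<q}. 2 * abs_cos m s * A a s t * A (a + c) s (t - 2 * s))
      \<le> abs_cos m s * (?g t (t - 2 * s) * (\<Sum>a\<in>{0..<q}. (A a s t)\<^sup>2)
        + ?g (t - 2 * s) t * (\<Sum>a\<in>{0..<q}. (A (a + c) s (t - 2 * s))\<^sup>2))"
      by (simp add: sum.distrib flip: sum_distrib_left)
    then show ?thesis by (simp only: shift flip: W_def)
  qed
  then have "(\<Sum>t\<in>{0..<m}. \<Sum>a\<in>{0..<q}. 2 * abs_cos m s * A a s t * A (a + c) s (t - 2 * s))
      \<le> (\<Sum>t\<in>{0..<m}. abs_cos m s * (?g t (t - 2 * s) * W t + ?g (t - 2 * s) t * W (t - 2 * s)))"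
    by (rule sum_mono)
  also have "\<dots> = abs_cos m s * ((\<Sum>t\<in>{0..<m}. ?g t (t - 2 * s) * W t)
      + (\<Sum>t\<in>{0..<m}. ?g (t - 2 * s) t * W (t - 2 * s)))"
    by (simp add: sum.distrib flip: sum_distrib_left)
  also have "(\<Sum>t\<in>{0..<m}. ?g (t - 2 * s) t * W (t - 2 * s)) = (\<Sum>t\<in>{0..<m}. ?g t (t + 2 * s) * W t)"
  proof -
    have "circ_abs m (t mod m) = circ_abs m t" "circ_abs m (t mod m + 2 * s) = circ_abs m (t + 2 * s)" for t
      by (intro circ_abs_cong; simp add: mod_simps)+
    then show ?thesis
      using sum_periodic_shift[OF m, of "\<lambda>t. ?g t (t + 2 * s) * W t" "- 2 * s"] W by simp
  qed
  finally show "(\<Sum>t\<in>{0..<m}. \<Sum>a\<in>{0..<q}. 2 * abs_cos m s * A a s t * A (a + c) s (t - 2 * s))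
     \<le> (\<Sum>t\<in>{0..<m}. abs_cos m s * ggw_pair m s t * (\<Sum>a\<in>{0..<q}. (A a s t)\<^sup>2))"
    by (simp add: W_def ggw_pair_def sum.distrib sum_distrib_left algebra_simps)
qed

text \<open>The shears fix the frequency \<open>0\<close>, where only the cyclic coordinate \<open>a\<close> keeps the graph away
  from being bipartite.\<close>

lemma circulant_12_ge:
  fixes h :: "int \<Rightarrow> real"
  assumes q: "q > 0" and per: "\<And>a. h (a mod q) = h a"
  shows "(\<Sum>a\<in>{0..<q}. h a * h (a + 1) + h a * h (a + 2)) \<ge> - (9/8) * (\<Sum>a\<in>{0..<q}. (h a)\<^sup>2)"
proof -
  have per': "h ((a + c) mod q) = h (a + c)" "h (a mod q + c) = h (a + c)" for a c
    using per[of "a + c"] per[of "a mod q + c"] by (simp_all add: mod_simps)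
  have shift: "(\<Sum>a\<in>{0..<q}. (h (a + c))\<^sup>2) = (\<Sum>a\<in>{0..<q}. (h a)\<^sup>2)" for c
    by (rule sum_periodic_shift[OF q]) (simp add: per)
  have shift': "(\<Sum>a\<in>{0..<q}. h (a + 1) * h (a + 2)) = (\<Sum>a\<in>{0..<q}. h a * h (a + 1))"
    using sum_periodic_shift[OF q, of "\<lambda>a. h a * h (a + 1)" 1] by (simp add: per per' add.assoc)
  \<comment> \<open>At the character of angle theta the form is cos theta + cos (2 theta). Its
    minimum -9/8 is attained at cos theta = -1/4, where 2 cos theta + 1/2 vanishes; hence the middle
    coefficient 1/2 of the square.\<close>
  have "0 \<le> (\<Sum>a\<in>{0..<q}. (h a + h (a + 1) / 2 + h (a + 2))\<^sup>2)"
    by (intro sum_nonneg) simp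
  also have "\<dots> = (\<Sum>a\<in>{0..<q}. (h a)\<^sup>2 + (h (a + 1))\<^sup>2 / 4 + (h (a + 2))\<^sup>2
      + h a * h (a + 1) + h (a + 1) * h (a + 2) + 2 * (h a * h (a + 2)))"
    by (intro sum.cong refl) (simp add: power2_eq_square field_simps)
  finally show ?thesis
    by (simp add: sum.distrib shift shift' flip: sum_distrib_left sum_divide_distrib)
qed

text \<open>In terms of the graph with the eight neighbours given by the four shears and their inverses,
  the smallest eigenvalue is at least \<open>- 73/10\<close>, bounded away from minus the degree.\<close>

lemma gabber_galil:
  fixes f :: "int \<Rightarrow> int \<Rightarrow> int \<Rightarrow> real"
  assumes m: "m > 0" and q: "q > 0"
    and perx: "\<And>a x y. f a (x mod m) y = f a x y"
    and pery: "\<And>a x y. f a x (y mod m) = f a x y"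
    and pera: "\<And>a x y. f (a mod q) x y = f a x y"
  shows "(\<Sum>a\<in>{0..<q}. \<Sum>x\<in>{0..<m}. \<Sum>y\<in>{0..<m}. f a x y *
      (f (a + 1) (x + 2 * y) y + f (a + 1) (x + 2 * y + 1) y
        + (f (a + 2) x (y + 2 * x) + f (a + 2) x (y + 2 * x + 1))))
    \<ge> - (73/20) * (\<Sum>a\<in>{0..<q}. \<Sum>x\<in>{0..<m}. \<Sum>y\<in>{0..<m}. (f a x y)\<^sup>2)"
    (is "?L \<ge> - (73/20) * ?S")
proof -
  define F where "F a s t = dft m (f a) s t" for a s t
  define h where "h a x y = f (a + 1) (x + 2 * y) y + f (a + 1) (x + 2 * y + 1) y
        + (f (a + 2) x (y + 2 * x) + f (a + 2) x (y + 2 * x + 1))" for a x y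
  define W where "W s t = (\<Sum>a\<in>{0..<q}. (norm (F a s t))\<^sup>2)" for s t
  \<comment> \<open>Frequency 0 is neither moved nor damped by the shears, so it is removed from the
    amplitudes. \<open>A\<close> stays periodic, and \<open>shear_form_le\<close> applies on the
    whole torus.\<close>
  define A where "A a s t = (if m dvd s \<and> m dvd t then 0 else norm (F a s t))" for a s t
  define R where "R s t = (\<Sum>a\<in>{0..<q}. Re (cnj (F a s t) * dft m (h a) s t))" for s t
  have F_cong: "F a s t = F a' s' t'" if "s mod m = s' mod m" "t mod m = t' mod m" "a mod q = a' mod q"
    for a a' s s' t t'
  proof -
    have "f a = f a'" using that(3) pera by (metis ext)
    then show ?thesis using dft_cong[OF m that(1,2)] by (simp add: F_def)
  qed
  have A_per: "A a (s mod m) t = A a s t" "A a s (t mod m) = A a s t" "A (a mod q) s t = A a s t" for a s t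
    unfolding A_def using F_cong[of s "s mod m" t t a a] F_cong[of s s t "t mod m" a a]
      F_cong[of s s t t a "a mod q"] by (simp_all add: dvd_mod_iff)
  have dft_h: "dft m (h a) s t = (1 + ech m (- s)) * F (a + 1) s (t - 2 * s)
      + (1 + ech m (- t)) * F (a + 2) (s - 2 * t) t" for a s t
  proof -
    have 1: "dft m (\<lambda>x y. f (a + 1) (x + 2 * y + k) y) s t = ech m (- (s * k)) * F (a + 1) s (t - 2 * s)" for k
      unfolding F_def by (rule dft_shear[OF m]) (rule perx)
    have 2: "dft m (\<lambda>x y. f (a + 2) x (y + 2 * x + k)) s t = ech m (- (t * k)) * F (a + 2) (s - 2 * t) t" for k
    proof -
      have "dft m (\<lambda>x y. f (a + 2) x (y + 2 * x + k)) s t = dft m (\<lambda>x y. f (a + 2) y (x + 2 * y + k)) t s"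
        by (rule dft_swap)
      also have "\<dots> = ech m (- (t * k)) * dft m (\<lambda>x y. f (a + 2) y x) t (s - 2 * t)"
        by (rule dft_shear[OF m]) (rule pery)
      also have "dft m (\<lambda>x y. f (a + 2) y x) t (s - 2 * t) = F (a + 2) (s - 2 * t) t"
        unfolding F_def by (rule dft_swap)
      finally show ?thesis .
    qed
    have 3: "dft m (h a) s t
      = dft m (\<lambda>x y. f (a + 1) (x + 2 * y + 0) y) s t + dft m (\<lambda>x y. f (a + 1) (x + 2 * y + 1) y) s t
        + (dft m (\<lambda>x y. f (a + 2) x (y + 2 * x + 0)) s t + dft m (\<lambda>x y. f (a + 2) x (y + 2 * x + 1)) s t)"
      by (simp add: dft_def h_def ring_distribs sum.distrib)
    show ?thesis unfolding 1 2 3 by (simp add: ring_distribs)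
  qed
  \<comment> \<open>At (0, 0) both multipliers \<open>1 + ech m 0\<close> equal 2, whence 9/4 = 2 *
    9/8 from \<open>circulant_12_ge\<close>. Elsewhere a sheared frequency is again nonzero, so
    \<open>A\<close> is the full norm there.\<close>
  have R_ge: "R s t \<ge> (if s = 0 \<and> t = 0 then - (9/4) * W s t else 0)
      - (\<Sum>a\<in>{0..<q}. 2 * abs_cos m s * A a s t * A (a + 1) s (t - 2 * s))
      - (\<Sum>a\<in>{0..<q}. 2 * abs_cos m t * A a s t * A (a + 2) (s - 2 * t) t)"
    if st: "s \<in> {0..<m}" "t \<in> {0..<m}" for s t
  proof (cases "s = 0 \<and> t = 0")
    case True
    define g where "g a = (\<Sum>x\<in>{0..<m}. \<Sum>y\<in>{0..<m}. f a x y)" for a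
    have F0: "F a 0 0 = of_real (g a)" for a by (simp add: F_def dft_def g_def)
    have "- (9/8) * (\<Sum>a\<in>{0..<q}. (g a)\<^sup>2) \<le> (\<Sum>a\<in>{0..<q}. g a * g (a + 1) + g a * g (a + 2))"
      by (rule circulant_12_ge[OF q]) (simp add: g_def pera)
    moreover have "R 0 0 = 2 * (\<Sum>a\<in>{0..<q}. g a * g (a + 1) + g a * g (a + 2))"
      by (simp add: R_def dft_h F0 sum_distrib_left algebra_simps)
    moreover have "W 0 0 = (\<Sum>a\<in>{0..<q}. (g a)\<^sup>2)" by (simp add: W_def F0)
    ultimately show ?thesis using True by (simp add: A_def)
  next
    case False
    have A_eq: "A a s t = norm (F a s t)" "A a s (t - 2 * s) = norm (F a s (t - 2 * s))"
      "A a (s - 2 * t) t = norm (F a (s - 2 * t) t)" for a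
    proof -
      have nz: "\<not> (m dvd s \<and> m dvd t)" using False st by (auto dest: zdvd_imp_le)
      have "m dvd s \<Longrightarrow> m dvd t - 2 * s \<longleftrightarrow> m dvd t" "m dvd t \<Longrightarrow> m dvd s - 2 * t \<longleftrightarrow> m dvd s"
        by (simp_all add: dvd_diff_left_iff dvd_mult)
      with nz show "A a s t = norm (F a s t)" "A a s (t - 2 * s) = norm (F a s (t - 2 * s))"
        "A a (s - 2 * t) t = norm (F a (s - 2 * t) t)" by (auto simp: A_def)
    qed
    have "Re (cnj (F a s t) * dft m (h a) s t) \<ge> - (2 * abs_cos m s * A a s t * A (a + 1) s (t - 2 * s))
        - 2 * abs_cos m t * A a s t * A (a + 2) (s - 2 * t) t" for a
    proof -
      have "\<bar>Re (cnj (F a s t) * dft m (h a) s t)\<bar> \<le> norm (cnj (F a s t) * dft m (h a) s t)"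
        by (rule abs_Re_le_cmod)
      also have "\<dots> \<le> norm (F a s t) * (norm (1 + ech m (- s)) * norm (F (a + 1) s (t - 2 * s))
          + norm (1 + ech m (- t)) * norm (F (a + 2) (s - 2 * t) t))"
        unfolding dft_h norm_mult complex_mod_cnj
        by (intro mult_left_mono norm_triangle_le) (simp_all add: norm_mult)
      also have "\<dots> = 2 * abs_cos m s * A a s t * A (a + 1) s (t - 2 * s)
          + 2 * abs_cos m t * A a s t * A (a + 2) (s - 2 * t) t"
        unfolding A_eq norm_1_plus_ech abs_cos_def by (simp add: algebra_simps)
      finally show ?thesis by linarith
    qed
    then have "(\<Sum>a\<in>{0..<q}. - (2 * abs_cos m s * A a s t * A (a + 1) s (t - 2 * s))
        - 2 * abs_cos m t * A a s t * A (a + 2) (s - 2 * t) t) \<le> R s t"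
      unfolding R_def by (rule sum_mono)
    moreover have "(if s = 0 \<and> t = 0 then - (9/4) * W s t else 0) = 0" using False by auto
    ultimately show ?thesis unfolding sum_subtractf sum_negf by linarith
  qed
  define D where "D s t = (\<Sum>a\<in>{0..<q}. (A a s t)\<^sup>2)" for s t
  have 1: "(\<Sum>s\<in>{0..<m}. \<Sum>t\<in>{0..<m}. \<Sum>a\<in>{0..<q}. 2 * abs_cos m s * A a s t * A (a + 1) s (t - 2 * s))
     \<le> (\<Sum>s\<in>{0..<m}. \<Sum>t\<in>{0..<m}. abs_cos m s * ggw_pair m s t * D s t)"
    unfolding D_def by (rule shear_form_le[OF m q]) (rule A_per)+
  \<comment> \<open>The second shear is the first one with the two coordinates exchanged.\<close>
  have 2: "(\<Sum>s\<in>{0..<m}. \<Sum>t\<in>{0..<m}. \<Sum>a\<in>{0..<q}. 2 * abs_cos m t * A a s t * A (a + 2) (s - 2 * t) t)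
     \<le> (\<Sum>s\<in>{0..<m}. \<Sum>t\<in>{0..<m}. abs_cos m t * ggw_pair m t s * D s t)"
    unfolding D_def
    by (subst (1 3) sum.swap, rule shear_form_le[OF m q, of "\<lambda>a s t. A a t s"]) (rule A_per)+
  \<comment> \<open>At frequency 0 this is 9/4 <= 73/20, elsewhere it is
    \<open>ggw_pointwise\<close>.\<close>
  have pw: "- (73/20) * W s t \<le> (if s = 0 \<and> t = 0 then - (9/4) * W s t else 0)
      - abs_cos m s * ggw_pair m s t * D s t - abs_cos m t * ggw_pair m t s * D s t"
    if st: "s \<in> {0..<m}" "t \<in> {0..<m}" for s t
  proof -
    have W0: "W s t \<ge> 0" by (simp add: W_def sum_nonneg)
    show ?thesis
    proof (cases "s = 0 \<and> t = 0")
      case True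
      then show ?thesis using W0 by (simp add: D_def A_def)
    next
      case False
      then have nz: "\<not> (m dvd s \<and> m dvd t)" using st by (auto dest: zdvd_imp_le)
      then have D: "D s t = W s t" by (auto simp: D_def W_def A_def)
      have "abs_cos m s * ggw_pair m s t * W s t + abs_cos m t * ggw_pair m t s * W s t \<le> 73/20 * W s t"
        using mult_right_mono[OF ggw_pointwise[OF m nz] W0] by (simp only: distrib_right)
      moreover have "(if s = 0 \<and> t = 0 then - (9/4) * W s t else 0) = 0" using False by auto
      ultimately show ?thesis unfolding D by linarith
    qed
  qed
  have "- (73/20) * (\<Sum>s\<in>{0..<m}. \<Sum>t\<in>{0..<m}. W s t)
      \<le> (\<Sum>s\<in>{0..<m}. \<Sum>t\<in>{0..<m}. (if s = 0 \<and> t = 0 then - (9/4) * W s t else 0)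
      - abs_cos m s * ggw_pair m s t * D s t - abs_cos m t * ggw_pair m t s * D s t)"
    unfolding sum_distrib_left by (intro sum_mono pw)
  also have "\<dots> \<le> (\<Sum>s\<in>{0..<m}. \<Sum>t\<in>{0..<m}. (if s = 0 \<and> t = 0 then - (9/4) * W s t else 0)
      - (\<Sum>a\<in>{0..<q}. 2 * abs_cos m s * A a s t * A (a + 1) s (t - 2 * s))
      - (\<Sum>a\<in>{0..<q}. 2 * abs_cos m t * A a s t * A (a + 2) (s - 2 * t) t))"
    using 1 2 unfolding sum_subtractf by linarith
  also have "\<dots> \<le> (\<Sum>s\<in>{0..<m}. \<Sum>t\<in>{0..<m}. R s t)"
    by (intro sum_mono R_ge)
  also have "\<dots> = Re (\<Sum>a\<in>{0..<q}. \<Sum>s\<in>{0..<m}. \<Sum>t\<in>{0..<m}. cnj (F a s t) * dft m (h a) s t)"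
    unfolding R_def Re_sum by (subst (2) sum.swap, subst sum.swap, rule refl)
  also have "(\<Sum>a\<in>{0..<q}. \<Sum>s\<in>{0..<m}. \<Sum>t\<in>{0..<m}. cnj (F a s t) * dft m (h a) s t)
      = of_real (of_int (m\<^sup>2) * ?L)"
    unfolding F_def parseval[OF m] unfolding h_def
    by (simp only: of_real_mult of_real_of_int_eq of_real_sum flip: sum_distrib_left)
  also have "Re \<dots> = of_int (m\<^sup>2) * ?L" by (rule Re_complex_of_real)
  finally have main: "- (73/20) * (\<Sum>s\<in>{0..<m}. \<Sum>t\<in>{0..<m}. W s t) \<le> of_int (m\<^sup>2) * ?L" .
  have "complex_of_real (\<Sum>s\<in>{0..<m}. \<Sum>t\<in>{0..<m}. W s t)
      = (\<Sum>a\<in>{0..<q}. \<Sum>s\<in>{0..<m}. \<Sum>t\<in>{0..<m}. cnj (F a s t) * F a s t)"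
    unfolding W_def of_real_sum complex_norm_square
    by (subst (2) sum.swap, subst sum.swap) (simp add: mult.commute)
  also have "\<dots> = of_real (of_int (m\<^sup>2) * ?S)"
    unfolding F_def parseval[OF m] power2_eq_square[of "f _ _ _"]
    by (simp only: of_real_mult of_real_of_int_eq of_real_sum flip: sum_distrib_left)
  finally have "(\<Sum>s\<in>{0..<m}. \<Sum>t\<in>{0..<m}. W s t) = of_int (m\<^sup>2) * ?S"
    by (simp only: of_real_eq_iff)
  with main have "of_int (m\<^sup>2) * (- (73/20) * ?S) \<le> of_int (m\<^sup>2) * ?L" by simp
  then show ?thesis using m by (subst (asm) mult_le_cancel_left_pos) simp_all
qed

section \<open>Graphs given by port numberings\<close>

text \<open>The port at the far end of an edge is a function \<open>rv\<close> of the port at the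
  near end alone, as in a graph generated by permutations and their inverses. A graph and both its
  doubles share \<open>rv\<close>, so ports cannot help to tell the doubles apart.\<close>

locale port_graph =
  fixes V :: "'v::countable set" and nb :: "'v \<Rightarrow> nat \<Rightarrow> 'v" and rv :: "nat \<Rightarrow> nat" and d :: nat
  assumes finite_V: "finite V"
    and nb_in: "v \<in> V \<Longrightarrow> i < d \<Longrightarrow> nb v i \<in> V"
    and rv_less: "i < d \<Longrightarrow> rv i < d"
    and nb_rv: "v \<in> V \<Longrightarrow> i < d \<Longrightarrow> nb (nb v i) (rv i) = v"
    and nb_inj: "v \<in> V \<Longrightarrow> inj_on (nb v) {..<d}"
    and nb_neq: "v \<in> V \<Longrightarrow> i < d \<Longrightarrow> nb v i \<noteq> v"
begin

section \<open>Realisation as a simple graph on natural numbers\<close>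

definition verts :: "nat set" where
  "verts = to_nat ` V"

definition edge :: "'v \<Rightarrow> nat \<Rightarrow> nat set" where
  "edge v i = {to_nat v, to_nat (nb v i)}"

definition edges :: "nat set set" where
  "edges = (\<lambda>(v, i). edge v i) ` (V \<times> {..<d})"

definition ports :: "nat \<Rightarrow> nat \<Rightarrow> nat" where
  "ports u i = to_nat (nb (from_nat u) i)"

lemma ports_to_nat: "ports (to_nat v) = (\<lambda>i. to_nat (nb v i))"
  by (simp add: ports_def fun_eq_iff)

lemma edge_in: "v \<in> V \<Longrightarrow> i < d \<Longrightarrow> edge v i \<in> edges"
  by (auto simp: edges_def)

lemma finite_edges: "finite edges"
  by (simp add: edges_def finite_V)

lemma card_verts: "card verts = card V"
  by (simp add: verts_def card_image)

lemma edge_rv: "v \<in> V \<Longrightarrow> i < d \<Longrightarrow> edge (nb v i) (rv i) = edge v i"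
  by (auto simp: edge_def nb_rv)

lemma pair_edge_iff:
  assumes "v \<in> V"
  shows "{u, to_nat v} \<in> edges \<longleftrightarrow> (\<exists>i<d. u = to_nat (nb v i))"
proof
  assume "{u, to_nat v} \<in> edges"
  then obtain w i where w: "w \<in> V" "i < d" "{u, to_nat v} = {to_nat w, to_nat (nb w i)}"
    by (auto simp: edges_def edge_def)
  then consider "u = to_nat w" "v = nb w i" | "v = w" "u = to_nat (nb w i)"
    by (auto simp: doubleton_eq_iff)
  then show "\<exists>i<d. u = to_nat (nb v i)"
    by cases (use w nb_rv rv_less in metis)+
next
  assume "\<exists>i<d. u = to_nat (nb v i)"
  then show "{u, to_nat v} \<in> edges"
    using edge_in[OF assms] by (auto simp: edge_def insert_commute)
qed

lemma neighbours_edges: "v \<in> V \<Longrightarrow> neighbours edges (to_nat v) = (\<lambda>i. to_nat (nb v i)) ` {..<d}"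
  by (auto simp: neighbours_def pair_edge_iff)

lemma inj_to_nat_nb: "v \<in> V \<Longrightarrow> inj_on (\<lambda>i. to_nat (nb v i)) {..<d}"
  using nb_inj by (auto simp: inj_on_def)

lemma vertex_degree_edges: "v \<in> V \<Longrightarrow> vertex_degree edges (to_nat v) = d"
  by (simp add: vertex_degree_def neighbours_edges card_image inj_to_nat_nb)

lemma simple: "simple_graph verts edges"
proof -
  have "to_nat v \<noteq> to_nat (nb v i)" if "v \<in> V" "i < d" for v i
    using nb_neq[OF that] by auto
  then show ?thesis
    unfolding simple_graph_def edges_def verts_def edge_def using finite_V nb_in by auto
qed

lemma regular: "regular d verts edges"
  by (auto simp: regular_def verts_def vertex_degree_edges)

lemma port_numbering: "port_numbering verts edges ports"
  unfolding port_numbering_def verts_def bij_betw_def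
  by (auto simp: vertex_degree_edges neighbours_edges ports_to_nat inj_to_nat_nb)

lemma port_to_nb:
  assumes "v \<in> V" "i < d" shows "port_to edges ports (to_nat v) (to_nat (nb v i)) = i"
proof -
  have "inv_into {..<d} (\<lambda>i. to_nat (nb v i)) (to_nat (nb v i)) = i"
    using assms inj_to_nat_nb by (intro inv_into_f_f[where f="\<lambda>i. to_nat (nb v i)"]) auto
  then show ?thesis using assms by (simp add: port_to_def vertex_degree_edges ports_to_nat)
qed

lemma port_to_nb_rv:
  assumes "v \<in> V" "i < d" shows "port_to edges ports (to_nat (nb v i)) (to_nat v) = rv i"
  using port_to_nb[of "nb v i" "rv i"] assms by (simp add: nb_in rv_less nb_rv)

section \<open>Runs of an algorithm, expected output size and cuts\<close>

definition state :: "('s, 'm) local_algorithm \<Rightarrow> (nat \<Rightarrow> nat \<Rightarrow> bool) \<Rightarrow> nat \<Rightarrow> 'v \<Rightarrow> 's" where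
  "state A \<omega> t v = local_state A verts edges ports \<omega> t (to_nat v)"

lemma state_0: "v \<in> V \<Longrightarrow> state A \<omega> 0 v = init A (card V) d (\<omega> (to_nat v))"
  by (simp add: state_def vertex_degree_edges card_verts)

lemma state_Suc: "v \<in> V \<Longrightarrow> state A \<omega> (Suc t) v =
    receive A (state A \<omega> t v) (map (\<lambda>i. send A (state A \<omega> t (nb v i)) (rv i)) [0..<d])"
  by (auto simp: state_def vertex_degree_edges ports_def port_to_nb_rv intro!: arg_cong2[where f="receive A"])

lemma edge_in_output_iff:
  assumes "v \<in> V" "i < d"
  shows "edge v i \<in> output_edges A verts edges ports \<omega> \<longleftrightarrow>
    (let st = state A \<omega> (rounds A (card V)) in
      decide A (st v, i) (st (nb v i), rv i) \<or> decide A (st (nb v i), rv i) (st v, i))"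
proof -
  let ?st = "local_state A verts edges ports \<omega> (rounds A (card verts))"
  let ?D = "\<lambda>u w. decide A (?st u, port_to edges ports u w) (?st w, port_to edges ports w u)"
  have "edge v i \<in> output_edges A verts edges ports \<omega> \<longleftrightarrow>
      (\<exists>u w. edge v i = {u, w} \<and> {u, w} \<in> edges \<and> ?D u w)"
    by (simp add: output_edges_def Let_def)
  also have "\<dots> \<longleftrightarrow> ?D (to_nat v) (to_nat (nb v i)) \<or> ?D (to_nat (nb v i)) (to_nat v)"
  proof
    assume "\<exists>u w. edge v i = {u, w} \<and> {u, w} \<in> edges \<and> ?D u w"
    then obtain u w where "edge v i = {u, w}" "?D u w" by blast
    then show "?D (to_nat v) (to_nat (nb v i)) \<or> ?D (to_nat (nb v i)) (to_nat v)"
      unfolding edge_def doubleton_eq_iff by blast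
  next
    assume "?D (to_nat v) (to_nat (nb v i)) \<or> ?D (to_nat (nb v i)) (to_nat v)"
    moreover have "edge v i = {to_nat v, to_nat (nb v i)}" "edge v i = {to_nat (nb v i), to_nat v}"
      by (auto simp: edge_def)
    ultimately show "\<exists>u w. edge v i = {u, w} \<and> {u, w} \<in> edges \<and> ?D u w"
      using edge_in[OF assms] by (elim disjE; intro exI conjI) (assumption | simp)+
  qed
  finally show ?thesis
    by (simp add: port_to_nb[OF assms] port_to_nb_rv[OF assms] state_def card_verts Let_def)
qed

text \<open>Every edge comes from exactly two pairs, \<open>(v, i)\<close> and
  \<open>(nb v i, rv i)\<close>. Counting over such directed edges lets the two doubles share an
  index set although their edge sets differ.\<close>

lemma sum_edge:
  fixes g :: "nat set \<Rightarrow> real"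
  shows "(\<Sum>v\<in>V. \<Sum>i<d. g (edge v i)) = 2 * (\<Sum>e\<in>edges. g e)"
proof -
  let ?D = "V \<times> {..<d}" and ?h = "\<lambda>(v, i). edge v i"
  have two: "card {x \<in> ?D. ?h x = e} = 2" if e: "e \<in> edges" for e
  proof -
    obtain v i where vi: "v \<in> V" "i < d" "e = edge v i"
      using e by (auto simp: edges_def)
    have "{x \<in> ?D. ?h x = e} = {(v, i), (nb v i, rv i)}"
    proof (intro equalityI subsetI)
      fix x assume "x \<in> {x \<in> ?D. ?h x = e}"
      then obtain w j where x: "x = (w, j)" "w \<in> V" "j < d" "edge w j = edge v i"
        using vi by auto
      then consider "w = v" "nb v j = nb v i" | "w = nb v i" "nb w j = v"
        by (auto simp: edge_def doubleton_eq_iff)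
      then show "x \<in> {(v, i), (nb v i, rv i)}"
      proof cases
        case 1
        then show ?thesis using x vi nb_inj[of v] by (auto simp: inj_on_def)
      next
        case 2
        then have "nb w j = nb w (rv i)" using vi nb_rv by auto
        then have "j = rv i" using x vi nb_inj[of w] rv_less[of i] by (auto simp: inj_on_def)
        then show ?thesis using x 2 by simp
      qed
    next
      fix x assume "x \<in> {(v, i), (nb v i, rv i)}"
      then show "x \<in> {x \<in> ?D. ?h x = e}" using vi nb_in rv_less edge_rv by auto
    qed
    moreover have "(v, i) \<noteq> (nb v i, rv i)" using nb_neq[of v i] vi by auto
    ultimately show ?thesis by simp
  qed
  have "(\<Sum>v\<in>V. \<Sum>i<d. g (edge v i)) = (\<Sum>x\<in>?D. g (?h x))"
    by (simp add: sum.cartesian_product case_prod_unfold)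
  also have "\<dots> = (\<Sum>e\<in>edges. \<Sum>x\<in>{x \<in> ?D. ?h x = e}. g (?h x))"
    by (rule sum.group[symmetric]) (auto simp: finite_V finite_edges edge_in)
  also have "\<dots> = (\<Sum>e\<in>edges. real (card {x \<in> ?D. ?h x = e}) * g e)"
    by (intro sum.cong refl) simp
  also have "\<dots> = (\<Sum>e\<in>edges. 2 * g e)"
    by (intro sum.cong refl) (simp add: two)
  finally show ?thesis by (simp add: sum_distrib_left)
qed

lemma card_edges: "2 * real (card edges) = real d * real (card V)"
  using sum_edge[of "\<lambda>_. 1"] by (simp add: mult.commute)

text \<open>Linearity of expectation over the edges, resting on the measurability of the events that
  a given edge joins the output.\<close>

lemma expected_output_size_eq:
  assumes "computes_cut A verts edges ports"
  shows "2 * expected_output_size A verts edges ports = (\<Sum>v\<in>V. \<Sum>i<d.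
    measure (random_bits verts) {\<omega> \<in> space (random_bits verts). edge v i \<in> output_edges A verts edges ports \<omega>})"
proof -
  let ?M = "random_bits verts" and ?O = "output_edges A verts edges ports"
  interpret prob_space ?M
    unfolding random_bits_def by (intro prob_space_PiM prob_space_measure_pmf)
  have meas: "{\<omega> \<in> space ?M. e \<in> ?O \<omega>} \<in> sets ?M" if "e \<in> edges" for e
    using assms that by (simp add: computes_cut_def)
  have sub: "?O \<omega> \<subseteq> edges" for \<omega>
    by (auto simp: output_edges_def Let_def)
  have "real (card (?O \<omega>)) = (\<Sum>e\<in>edges. indicator {\<omega> \<in> space ?M. e \<in> ?O \<omega>} \<omega>)"
    if "\<omega> \<in> space ?M" for \<omega>
  proof -
    have "(\<Sum>e\<in>edges. indicator {\<omega> \<in> space ?M. e \<in> ?O \<omega>} \<omega>) = (\<Sum>e\<in>edges. if e \<in> ?O \<omega> then 1 else (0::real))"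
      using that by (intro sum.cong) (auto simp: indicator_def)
    also have "\<dots> = real (card (edges \<inter> ?O \<omega>))"
      by (simp add: sum.If_cases finite_edges Int_def)
    finally show ?thesis using sub[of \<omega>] by (simp add: Int_absorb1)
  qed
  then have "expected_output_size A verts edges ports
      = (\<integral>\<omega>. (\<Sum>e\<in>edges. indicator {\<omega> \<in> space ?M. e \<in> ?O \<omega>} \<omega>) \<partial>?M)"
    unfolding expected_output_size_def by (intro Bochner_Integration.integral_cong) auto
  also have "\<dots> = (\<Sum>e\<in>edges. measure ?M {\<omega> \<in> space ?M. e \<in> ?O \<omega>})"
  proof -
    have "integrable ?M (indicator B :: _ \<Rightarrow> real)" "(\<integral>\<omega>. indicator B \<omega> \<partial>?M) = measure ?M B"
      if "B \<in> sets ?M" for B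
      using that by (auto simp: integrable_indicator_iff emeasure_finite less_top[symmetric] sets.Int_space_eq2)
    then show ?thesis using meas by (subst Bochner_Integration.integral_sum) (auto intro!: sum.cong)
  qed
  finally have split: "expected_output_size A verts edges ports = (\<Sum>e\<in>edges. measure ?M {\<omega> \<in> space ?M. e \<in> ?O \<omega>})" .
  show ?thesis unfolding split by (rule sum_edge[symmetric])
qed

text \<open>The colouring is the indicator of one side. A crossing edge is seen from both of its
  ends, hence the factor 2.\<close>

lemma card_cut_le:
  assumes "is_cut verts edges F"
  obtains f :: "'v \<Rightarrow> bool" where
    "2 * real (card F) = real (card {(v, i) \<in> V \<times> {..<d}. f v \<noteq> f (nb v i)})"
proof -
  obtain S T where ST: "S \<union> T = verts" "S \<inter> T = {}" "F = crossing_edges edges S T"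
    using assms by (auto simp: is_cut_def)
  define f where "f v \<longleftrightarrow> to_nat v \<in> S" for v :: 'v
  have T: "to_nat v \<in> T \<longleftrightarrow> \<not> f v" if "v \<in> V" for v
    using that ST(1,2) by (auto simp: f_def verts_def)
  have iff: "edge v i \<in> F \<longleftrightarrow> f v \<noteq> f (nb v i)" if "v \<in> V" "i < d" for v i
    using that T[of v] T[of "nb v i"] nb_in[OF that] edge_in[OF that]
    by (auto simp: ST(3) crossing_edges_def edge_def doubleton_eq_iff f_def[symmetric])
  have "F \<subseteq> edges" by (auto simp: ST(3) crossing_edges_def)
  then have "2 * real (card F) = 2 * (\<Sum>e\<in>edges. of_bool (e \<in> F))"
    by (simp add: finite_edges Int_absorb1 of_bool_def sum.If_cases Int_def[symmetric])
  also have "\<dots> = (\<Sum>v\<in>V. \<Sum>i<d. of_bool (edge v i \<in> F))"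
    by (rule sum_edge[symmetric])
  also have "\<dots> = (\<Sum>v\<in>V. \<Sum>i<d. of_bool (f v \<noteq> f (nb v i)))"
    by (intro sum.cong refl) (simp add: iff)
  also have "\<dots> = (\<Sum>x\<in>V \<times> {..<d}. if f (fst x) \<noteq> f (nb (fst x) (snd x)) then 1 else 0)"
    by (simp only: sum.cartesian_product case_prod_unfold of_bool_def)
  also have "\<dots> = real (card (V \<times> {..<d} \<inter> {x. f (fst x) \<noteq> f (nb (fst x) (snd x))}))"
    by (subst sum.If_cases) (simp_all add: finite_V)
  also have "V \<times> {..<d} \<inter> {x. f (fst x) \<noteq> f (nb (fst x) (snd x))} = {(v, i) \<in> V \<times> {..<d}. f v \<noteq> f (nb v i)}"
    by auto
  finally show ?thesis by (rule that)
qed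

end

section \<open>Indistinguishability of the two doubles\<close>

context port_graph
begin

section \<open>Walks along ports and their parity\<close>

definition walk :: "'v \<Rightarrow> nat list \<Rightarrow> 'v" where
  "walk v is = foldl nb v is"

lemma walk_Nil [simp]: "walk v [] = v"
  and walk_snoc [simp]: "walk v (is @ [i]) = nb (walk v is) i"
  and walk_append: "walk v (is @ js) = walk (walk v is) js"
  and walk_Cons: "walk v (i # is) = walk (nb v i) is"
  by (simp_all add: walk_def)

lemma walk_in: "v \<in> V \<Longrightarrow> set is \<subseteq> {..<d} \<Longrightarrow> walk v is \<in> V"
  by (induction "is" rule: rev_induct) (simp_all add: nb_in)

lemma walk_rev: "v \<in> V \<Longrightarrow> set is \<subseteq> {..<d} \<Longrightarrow> walk (walk v is) (rev (map rv is)) = v"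
  by (induction "is" rule: rev_induct) (simp_all add: walk_Cons nb_rv walk_in)

text \<open>Closed walks may repeat vertices and edges. They are words in the ports, so counting the
  vertices that violate this becomes counting fixed points of words.\<close>

definition no_odd_closed_walk :: "nat \<Rightarrow> 'v \<Rightarrow> bool" where
  "no_odd_closed_walk R v \<longleftrightarrow>
    (\<forall>is. set is \<subseteq> {..<d} \<longrightarrow> length is \<le> R \<longrightarrow> odd (length is) \<longrightarrow> walk v is \<noteq> v)"

text \<open>Going out along \<open>is\<close> and back along \<open>js\<close> closes a walk of
  length at most 2 L.\<close>

lemma no_odd_closed_walk_parity:
  assumes "no_odd_closed_walk (2 * L) v" "v \<in> V" "set is \<subseteq> {..<d}" "set js \<subseteq> {..<d}"
    "length is \<le> L" "length js \<le> L" "walk v is = walk v js"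
  shows "even (length is) = even (length js)"
proof -
  let ?c = "is @ rev (map rv js)"
  have "walk v ?c = v" using assms walk_rev[of v js] by (simp add: walk_append)
  moreover have "set ?c \<subseteq> {..<d}" using assms rv_less by auto
  moreover have "length ?c \<le> 2 * L" using assms by simp
  ultimately have "even (length ?c)" using assms(1) unfolding no_odd_closed_walk_def by blast
  then show ?thesis by simp
qed

text \<open>\<open>dbl False\<close> is the disjoint union of two copies of the graph, \<open>dbl True\<close> is its bipartite
  double cover.\<close>

definition dbl :: "bool \<Rightarrow> 'v \<times> bool \<Rightarrow> nat \<Rightarrow> 'v \<times> bool" where
  "dbl \<tau> = (\<lambda>(v, b) i. (nb v i, b \<noteq> \<tau>))"

lemma port_graph_dbl: "port_graph (V \<times> UNIV) (dbl \<tau>) rv d"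
proof
  fix x :: "'v \<times> bool" assume "x \<in> V \<times> UNIV"
  then show "inj_on (dbl \<tau> x) {..<d}"
    using nb_inj by (cases x) (auto simp: dbl_def inj_on_def)
qed (use finite_V nb_in rv_less nb_rv nb_neq in \<open>auto simp: dbl_def\<close>)

lemma bipartite_dbl_True:
  "bipartite (port_graph.verts (V \<times> (UNIV :: bool set))) (port_graph.edges (V \<times> UNIV) (dbl True) d)"
proof -
  interpret B: port_graph "V \<times> UNIV" "dbl True" rv d by (rule port_graph_dbl)
  let ?S = "\<lambda>b. to_nat ` (V \<times> {b :: bool})"
  have "\<exists>s\<in>?S False. \<exists>t\<in>?S True. e = {s, t}" if e_in: "e \<in> B.edges" for e
  proof -
    obtain v b i where vi: "v \<in> V" "i < d" and e: "e = {to_nat (v, b), to_nat (nb v i, \<not> b)}"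
      using e_in unfolding B.edges_def B.edge_def by (auto simp: dbl_def)
    have "(if b then nb v i else v) \<in> V" "(if b then v else nb v i) \<in> V" using vi nb_in by auto
    moreover have "e = {to_nat (if b then nb v i else v, False), to_nat (if b then v else nb v i, True)}"
      using e by auto
    ultimately show ?thesis by blast
  qed
  moreover have "?S False \<union> ?S True = B.verts" by (auto simp: B.verts_def image_iff)
  moreover have "?S False \<inter> ?S True = {}" by auto
  ultimately show ?thesis unfolding bipartite_def by blast
qed

text \<open>Up to time \<open>T\<close> the ends of an edge only see a ball of radius \<open>T + 1\<close>. If that ball has no odd
  closed walk, it lifts to the double cover along the parity of the distance from \<open>v\<close>.\<close>

lemma state_dbl_eq:
  assumes v: "v \<in> V" and good: "no_odd_closed_walk (2 * (T + 1)) v"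
    and p: "\<And>u. p u \<longleftrightarrow> (\<exists>is. set is \<subseteq> {..<d} \<and> length is \<le> T + 1 \<and> odd (length is) \<and> walk v is = u)"
    and \<omega>': "\<And>u b. u \<in> V \<Longrightarrow> \<omega>' (to_nat (u, b)) = \<omega> (to_nat (u, b \<noteq> p u))"
    and "set is \<subseteq> {..<d}" "length is + t \<le> T + 1"
  shows "port_graph.state (V \<times> UNIV) (dbl True) d A \<omega> t (walk v is, b \<noteq> odd (length is))
       = port_graph.state (V \<times> UNIV) (dbl False) d A \<omega>' t (walk v is, b)"
  using assms(5,6)
proof (induction t arbitrary: "is")
  interpret B: port_graph "V \<times> UNIV" "dbl True" rv d by (rule port_graph_dbl)
  interpret G: port_graph "V \<times> UNIV" "dbl False" rv d by (rule port_graph_dbl)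
  case 0
  have u: "walk v is \<in> V" using 0 v by (simp add: walk_in)
  \<comment> \<open>By \<open>good\<close>, no vertex is reached by both an odd and an even walk of
    length at most T + 1. So p, although defined by existence, is the parity of every such
    walk.\<close>
  have "p (walk v is) \<longleftrightarrow> odd (length is)"
  proof
    assume "p (walk v is)"
    then obtain js where "set js \<subseteq> {..<d}" "length js \<le> T + 1" "odd (length js)" "walk v js = walk v is"
      unfolding p by blast
    then show "odd (length is)"
      using no_odd_closed_walk_parity[OF good v, of js "is"] 0 by simp
  next
    assume "odd (length is)"
    then show "p (walk v is)" unfolding p using 0 by auto
  qed
  then show ?case using u by (simp add: B.state_0 G.state_0 \<omega>')
next
  interpret B: port_graph "V \<times> UNIV" "dbl True" rv d by (rule port_graph_dbl)
  interpret G: port_graph "V \<times> UNIV" "dbl False" rv d by (rule port_graph_dbl)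
  case (Suc t)
  have u: "walk v is \<in> V" using Suc.prems v by (simp add: walk_in)
  have self: "B.state A \<omega> t (walk v is, b \<noteq> odd (length is)) = G.state A \<omega>' t (walk v is, b)"
    using Suc by simp
  \<comment> \<open>A neighbour costs one more step of the walk, paid for by one round less: length
    plus time stays at most T + 1.\<close>
  have nbs: "B.state A \<omega> t (dbl True (walk v is, b \<noteq> odd (length is)) i) = G.state A \<omega>' t (dbl False (walk v is, b) i)"
    if "i < d" for i
  proof -
    have "B.state A \<omega> t (walk v (is @ [i]), b \<noteq> odd (length (is @ [i]))) = G.state A \<omega>' t (walk v (is @ [i]), b)"
      using Suc.prems that by (intro Suc.IH) auto
    moreover have "(walk v (is @ [i]), b \<noteq> odd (length (is @ [i]))) = dbl True (walk v is, b \<noteq> odd (length is)) i"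
      by (auto simp: dbl_def)
    moreover have "(walk v (is @ [i]), b) = dbl False (walk v is, b) i" by (simp add: dbl_def)
    ultimately show ?thesis by simp
  qed
  have eq: "map (\<lambda>i. send A (B.state A \<omega> t (dbl True (walk v is, b \<noteq> odd (length is)) i)) (rv i)) [0..<d]
      = map (\<lambda>i. send A (G.state A \<omega>' t (dbl False (walk v is, b) i)) (rv i)) [0..<d]"
    using nbs by auto
  show ?case
    using u by (subst B.state_Suc, simp, subst G.state_Suc, simp) (simp only: eq self)
qed

text \<open>A coupling: \<open>flip\<close> exchanges the two layers of V x bool where p holds.
  Permuting independent, identically distributed bits preserves their measure, and by
  \<open>state_dbl_eq\<close> it turns the run on the cover, at both ends of the edge, into the run
  on the two copies.\<close>

lemma edge_prob_dbl_eq: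
  fixes A :: "('s, 'm) local_algorithm" and v :: 'v and i :: nat and b :: bool
  defines "M \<equiv> random_bits (port_graph.verts (V \<times> (UNIV :: bool set)))"
    and "out \<equiv> \<lambda>\<tau>. output_edges A (port_graph.verts (V \<times> (UNIV :: bool set)))
      (port_graph.edges (V \<times> UNIV) (dbl \<tau>) d) (port_graph.ports (dbl \<tau>))"
  assumes v: "v \<in> V" and i: "i < d"
    and good: "no_odd_closed_walk (2 * (rounds A (2 * card V) + 1)) v"
    and meas: "{\<omega> \<in> space M. port_graph.edge (dbl False) (v, b) i \<in> out False \<omega>} \<in> sets M"
  shows "measure M {\<omega> \<in> space M. port_graph.edge (dbl True) (v, b) i \<in> out True \<omega>}
    = measure M {\<omega> \<in> space M. port_graph.edge (dbl False) (v, b) i \<in> out False \<omega>}"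
proof -
  interpret B: port_graph "V \<times> UNIV" "dbl True" rv d by (rule port_graph_dbl)
  interpret G: port_graph "V \<times> UNIV" "dbl False" rv d by (rule port_graph_dbl)
  define T where "T = rounds A (2 * card V)"
  \<comment> \<open>Where no short odd walk from v arrives, p is False and \<open>flip\<close> does
    nothing; so \<open>flip\<close> is a permutation of all vertices, not only of those near
    v.\<close>
  define p where "p u \<longleftrightarrow> (\<exists>is. set is \<subseteq> {..<d} \<and> length is \<le> T + 1 \<and> odd (length is) \<and> walk v is = u)" for u
  define flip where "flip x = (fst x, snd x \<noteq> p (fst x))" for x :: "'v \<times> bool"
  define \<psi> where "\<psi> n = to_nat (flip (from_nat n))" for n
  define \<rho> where "\<rho> \<omega> = (\<lambda>n\<in>B.verts. \<omega> (\<psi> n))" for \<omega> :: "nat \<Rightarrow> nat \<Rightarrow> bool"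
  define N where "N = (\<Pi>\<^sub>M i\<in>(UNIV :: nat set). measure_pmf (bernoulli_pmf (1/2)))"
  have M: "M = (\<Pi>\<^sub>M v\<in>B.verts. N)" by (simp add: M_def random_bits_def N_def)
  have \<psi>_in: "\<psi> \<in> B.verts \<rightarrow> B.verts"
    by (auto simp: \<psi>_def B.verts_def flip_def)
  have "flip (flip x) = x" for x by (cases x) (auto simp: flip_def)
  then have "\<psi> (\<psi> n) = n" if "n \<in> B.verts" for n
    using that by (auto simp: \<psi>_def B.verts_def)
  then have \<psi>_inj: "inj_on \<psi> B.verts" by (rule inj_on_inverseI)
  have "prob_space N" unfolding N_def by (intro prob_space_PiM prob_space_measure_pmf)
  then have distr: "distr M M \<rho> = M"
    unfolding M \<rho>_def using distr_PiM_reindex[of B.verts "\<lambda>_. N" \<psi> B.verts] \<psi>_inj \<psi>_in by simp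
  have \<rho>_meas: "\<rho> \<in> measurable M M"
    unfolding M \<rho>_def using \<psi>_in by (intro measurable_restrict measurable_component_singleton) auto
  have iff: "B.edge (v, b) i \<in> out True \<omega> \<longleftrightarrow> G.edge (v, b) i \<in> out False (\<rho> \<omega>)" for \<omega>
  proof -
    have \<rho>: "\<rho> \<omega> (to_nat (u, c)) = \<omega> (to_nat (u, c \<noteq> p u))" if "u \<in> V" for u c
      using that by (auto simp: \<rho>_def \<psi>_def flip_def B.verts_def)
    \<comment> \<open>The ends of the edge are reached by walks of length 0 and 1; with T rounds
      this uses up the radius T + 1.\<close>
    have eq: "B.state A \<omega> T (walk v is, b \<noteq> odd (length is)) = G.state A (\<rho> \<omega>) T (walk v is, b)"
      if "set is \<subseteq> {..<d}" "length is \<le> 1" for "is"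
      by (rule state_dbl_eq[OF v good[folded T_def], where p = p and \<omega>' = "\<rho> \<omega>"])
         (rule p_def, erule \<rho>, use that in simp_all)
    have "B.state A \<omega> T (v, b) = G.state A (\<rho> \<omega>) T (v, b)"
      using eq[of "[]"] by simp
    moreover have "B.state A \<omega> T (dbl True (v, b) i) = G.state A (\<rho> \<omega>) T (dbl False (v, b) i)"
      using eq[of "[i]"] i by (simp add: dbl_def walk_Cons)
    ultimately show ?thesis
      using v i by (simp add: out_def B.edge_in_output_iff G.edge_in_output_iff card_cartesian_product
          T_def mult.commute Let_def)
  qed
  have "{\<omega> \<in> space M. B.edge (v, b) i \<in> out True \<omega>}
      = \<rho> -` {\<omega> \<in> space M. G.edge (v, b) i \<in> out False \<omega>} \<inter> space M"
    using iff measurable_space[OF \<rho>_meas] by auto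
  then have "measure M {\<omega> \<in> space M. B.edge (v, b) i \<in> out True \<omega>}
      = measure (distr M M \<rho>) {\<omega> \<in> space M. G.edge (v, b) i \<in> out False \<omega>}"
    using measure_distr[OF \<rho>_meas meas] by simp
  then show ?thesis by (simp add: distr)
qed

text \<open>At a good vertex the edge probabilities of the doubles agree; a bad one raises the sum
  by at most d, and two vertices lie over it. On the two copies the output is a cut as well, so it
  contains at most the fraction \<kappa> of the edges of each copy.\<close>

lemma cut_density_le_max_cut:
  fixes A :: "('s, 'm) local_algorithm" and \<kappa> c \<beta> :: real
  defines "W \<equiv> port_graph.verts (V \<times> (UNIV :: bool set))"
    and "E \<equiv> \<lambda>\<tau>. port_graph.edges (V \<times> UNIV) (dbl \<tau>) d"
    and "P \<equiv> \<lambda>\<tau>. port_graph.ports (dbl \<tau>)"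
  assumes cuts: "\<And>\<tau>. computes_cut A W (E \<tau>) (P \<tau>)"
    and approx: "expected_output_size A W (E True) (P True) \<ge> c * real (card (E True))"
    and max_cut: "\<And>f :: 'v \<Rightarrow> bool. real (card {(v, i) \<in> V \<times> {..<d}. f v \<noteq> f (nb v i)}) \<le> \<kappa> * (real d * real (card V))"
    and bad: "real (card {v \<in> V. \<not> no_odd_closed_walk (2 * (rounds A (2 * card V) + 1)) v}) \<le> \<beta> * real (card V)"
    and pos: "d > 0" "V \<noteq> {}"
  shows "c - \<beta> \<le> \<kappa>"
proof -
  interpret B: port_graph "V \<times> UNIV" "dbl True" rv d by (rule port_graph_dbl)
  interpret G: port_graph "V \<times> UNIV" "dbl False" rv d by (rule port_graph_dbl)
  let ?M = "random_bits W" and ?out = "\<lambda>\<tau>. output_edges A W (E \<tau>) (P \<tau>)"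
  let ?R = "2 * (rounds A (2 * card V) + 1)"
  \<comment> \<open>The number of edges of a double, which has 2 |V| vertices of degree d.\<close>
  define D where "D = real d * real (card V)"
  have D: "D > 0" using pos finite_V by (simp add: D_def card_gt_0_iff)
  interpret prob_space ?M
    unfolding random_bits_def by (intro prob_space_PiM prob_space_measure_pmf)
  define prT where "prT x i = prob {\<omega> \<in> space ?M. B.edge x i \<in> ?out True \<omega>}" for x i
  define prF where "prF x i = prob {\<omega> \<in> space ?M. G.edge x i \<in> ?out False \<omega>}" for x i
  have ET: "2 * expected_output_size A W (E True) (P True) = (\<Sum>x\<in>V \<times> UNIV. \<Sum>i<d. prT x i)"
    unfolding prT_def W_def E_def P_def
    using cuts[of True] by (intro B.expected_output_size_eq) (simp add: W_def E_def P_def)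
  have EF: "2 * expected_output_size A W (E False) (P False) = (\<Sum>x\<in>V \<times> UNIV. \<Sum>i<d. prF x i)"
    unfolding prF_def W_def E_def P_def
    using cuts[of False] by (intro G.expected_output_size_eq) (simp add: W_def E_def P_def)
  have "(\<Sum>i<d. prT x i) \<le> (\<Sum>i<d. prF x i) + real d * of_bool (\<not> no_odd_closed_walk ?R (fst x))"
    if "x \<in> V \<times> UNIV" for x
  proof (cases "no_odd_closed_walk ?R (fst x)")
    case True
    have "prT x i = prF x i" if "i < d" for i
    proof -
      obtain v b where x: "x = (v, b)" "v \<in> V" using \<open>x \<in> V \<times> UNIV\<close> by auto
      have "G.edge (v, b) i \<in> E False" unfolding E_def using x that by (intro G.edge_in) auto
      then have "{\<omega> \<in> space ?M. G.edge (v, b) i \<in> ?out False \<omega>} \<in> sets ?M"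
        using cuts[of False] by (simp add: computes_cut_def)
      then show ?thesis
        unfolding prT_def prF_def x(1) W_def E_def P_def
        using x that True by (intro edge_prob_dbl_eq) auto
    qed
    then show ?thesis using True by simp
  next
    case False
    have "(\<Sum>i<d. prT x i) \<le> (\<Sum>i<d. 1)" by (intro sum_mono) (simp add: prT_def)
    also have "\<dots> \<le> (\<Sum>i<d. prF x i) + real d" by (simp add: prF_def sum_nonneg)
    finally show ?thesis using False by simp
  qed
  then have "(\<Sum>x\<in>V \<times> UNIV. \<Sum>i<d. prT x i)
      \<le> (\<Sum>x\<in>V \<times> (UNIV :: bool set). (\<Sum>i<d. prF x i) + real d * of_bool (\<not> no_odd_closed_walk ?R (fst x)))"
    by (rule sum_mono)
  also have "\<dots> = (\<Sum>x\<in>V \<times> UNIV. \<Sum>i<d. prF x i)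
      + real d * (\<Sum>x\<in>V \<times> (UNIV :: bool set). of_bool (\<not> no_odd_closed_walk ?R (fst x)))"
    by (simp only: sum.distrib sum_distrib_left)
  also have "(\<Sum>x\<in>V \<times> (UNIV :: bool set). of_bool (\<not> no_odd_closed_walk ?R (fst x)))
      = 2 * (\<Sum>v\<in>V. of_bool (\<not> no_odd_closed_walk ?R v) :: real)"
  proof -
    have "(\<Sum>x\<in>V \<times> (UNIV :: bool set). g (fst x)) = (\<Sum>v\<in>V. \<Sum>b\<in>(UNIV :: bool set). g v)" for g :: "'v \<Rightarrow> real"
      by (simp only: sum.cartesian_product case_prod_unfold)
    then show ?thesis by (simp add: sum_distrib_left)
  qed
  also have "(\<Sum>v\<in>V. of_bool (\<not> no_odd_closed_walk ?R v) :: real)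
      = real (card {v \<in> V. \<not> no_odd_closed_walk ?R v})"
    by (simp add: of_bool_def sum.If_cases finite_V Int_def)
  finally have "2 * expected_output_size A W (E True) (P True) \<le> 2 * expected_output_size A W (E False) (P False)
      + real d * (2 * real (card {v \<in> V. \<not> no_odd_closed_walk ?R v}))"
    unfolding ET EF .
  also have "\<dots> \<le> 2 * expected_output_size A W (E False) (P False) + real d * (2 * (\<beta> * real (card V)))"
    using bad by (intro add_left_mono mult_left_mono) auto
  finally have 1: "expected_output_size A W (E True) (P True)
      \<le> expected_output_size A W (E False) (P False) + \<beta> * D" by (simp add: D_def mult_ac)
  have "real (card (?out False \<omega>)) \<le> \<kappa> * D" if cut: "is_cut W (E False) (?out False \<omega>)" for \<omega>
  proof -
    obtain f :: "'v \<times> bool \<Rightarrow> bool" where f: "2 * real (card (?out False \<omega>))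
        = real (card {(x, i) \<in> (V \<times> UNIV) \<times> {..<d}. f x \<noteq> f (dbl False x i)})"
      unfolding W_def E_def by (rule G.card_cut_le[OF cut[unfolded W_def E_def]])
    let ?C = "\<lambda>b. {(v, i) \<in> V \<times> {..<d}. f (v, b) \<noteq> f (nb v i, b)}"
    have "{(x, i) \<in> (V \<times> UNIV) \<times> {..<d}. f x \<noteq> f (dbl False x i)}
        = (\<Union>b\<in>UNIV. (\<lambda>(v, i). ((v, b), i)) ` ?C b)"
      by (auto simp: dbl_def image_iff)
    also have "card \<dots> \<le> (\<Sum>b\<in>UNIV. card ((\<lambda>(v, i). ((v, b), i)) ` ?C b))"
      by (rule card_UN_le) simp
    also have "\<dots> = (\<Sum>b\<in>UNIV. card (?C b))"
      by (intro sum.cong refl card_image) (auto simp: inj_on_def)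
    finally have "2 * real (card (?out False \<omega>)) \<le> (\<Sum>b\<in>UNIV. real (card (?C b)))"
      unfolding f by (simp only: of_nat_sum[symmetric] of_nat_le_iff)
    also have "\<dots> \<le> (\<Sum>b\<in>(UNIV :: bool set). \<kappa> * D)"
      proof (rule sum_mono)
      show "real (card (?C b)) \<le> \<kappa> * D" for b
        using max_cut[of "\<lambda>v. f (v, b)"] by (simp only: D_def)
    qed
    finally show ?thesis by simp
  qed
  then have AE: "AE \<omega> in ?M. real (card (?out False \<omega>)) \<le> \<kappa> * D"
    using cuts[of False] unfolding computes_cut_def by (auto elim: eventually_mono)
  have 2: "expected_output_size A W (E False) (P False) \<le> \<kappa> * D"
  proof (cases "integrable ?M (\<lambda>\<omega>. real (card (?out False \<omega>)))")
    case True
    then show ?thesis unfolding expected_output_size_def using AE by (rule integral_le_const)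
  next
    case False
    \<comment> \<open>A function that is not integrable has integral 0 by convention, so the bound
      only has to be nonnegative; a constant colouring, which cuts nothing, shows this.\<close>
    have "0 \<le> \<kappa> * D" using max_cut[of "\<lambda>_. True"] by (simp add: D_def)
    then show ?thesis
      unfolding expected_output_size_def using False by (simp add: not_integrable_integral_eq)
  qed
  have "card (V \<times> (UNIV :: bool set)) = 2 * card V" by (simp add: card_cartesian_product)
  then have "real (card (E True)) = D"
    using B.card_edges unfolding E_def D_def by simp
  then have "c * D \<le> \<kappa> * D + \<beta> * D" using approx 1 2 by simp
  then have "(c - \<beta>) * D \<le> \<kappa> * D" by (simp add: algebra_simps)
  then show ?thesis using D by simp
qed

end

section \<open>The Margulis graph\<close>

lemma port_graph_Plus:
  assumes "port_graph V1 nb1 rv d" "port_graph V2 nb2 rv d"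
  shows "port_graph (V1 <+> V2)
    (case_sum (\<lambda>v i. Inl (nb1 v i)) (\<lambda>v i. Inr (nb2 v i))) rv d"
proof -
  interpret G: port_graph V1 nb1 rv d by fact
  interpret H: port_graph V2 nb2 rv d by fact
  show ?thesis
  proof
    fix v :: "'a + 'b" assume "v \<in> V1 <+> V2"
    then show "inj_on (case_sum (\<lambda>v i. Inl (nb1 v i)) (\<lambda>v i. Inr (nb2 v i)) v) {..<d}"
      using G.nb_inj H.nb_inj by (auto simp: inj_on_def)
  qed (use G.finite_V H.finite_V G.nb_in H.nb_in G.rv_less G.nb_rv H.nb_rv G.nb_neq H.nb_neq in auto)
qed

text \<open>Ports below 9 are generators, the others their inverses in the same order. Both building
  blocks use this convention, so their union has a single reverse map.\<close>

definition opp :: "nat \<Rightarrow> nat" where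
  "opp i = (if i < 9 then i + 9 else i - 9)"

lemma mod_shift_cancel:
  fixes a :: int
  assumes "(a + b) mod m = (a + c) mod m" "\<bar>b - c\<bar> < m"
  shows "b = c"
proof -
  have "m dvd b - c" using assms(1) by (simp add: mod_eq_dvd_iff)
  then show ?thesis using assms(2) zdvd_imp_le[of m "\<bar>b - c\<bar>"] by (cases "b = c") auto
qed

definition circulant_nb :: "int \<Rightarrow> int \<Rightarrow> nat \<Rightarrow> int" where
  "circulant_nb r x i = (x + (if i < 9 then int i + 1 else 8 - int i)) mod r"

text \<open>The offsets are 1, ..., 9 and their negatives. Two of them differ by at most 18, so r >=
  19 keeps them distinct and nonzero modulo r.\<close>

lemma port_graph_circulant:
  assumes "r \<ge> 19" shows "port_graph {0..<r} (circulant_nb r) opp 18"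
proof
  fix v assume v: "v \<in> {0..<r}"
  have inj: "i = j" if "circulant_nb r v i = circulant_nb r v j" "i < 18" "j < 18" for i j
  proof -
    have "(if i < 9 then int i + 1 else 8 - int i) = (if j < 9 then int j + 1 else 8 - int j)"
      using that assms unfolding circulant_nb_def by (elim mod_shift_cancel) auto
    then show ?thesis by (auto split: if_splits)
  qed
  then show "inj_on (circulant_nb r v) {..<18}" by (auto simp: inj_on_def)
  fix i :: nat assume i: "i < 18"
  show "circulant_nb r v i \<in> {0..<r}" using assms by (simp add: circulant_nb_def)
  show "circulant_nb r (circulant_nb r v i) (opp i) = v"
    using v i by (auto simp: circulant_nb_def opp_def mod_simps)
  show "circulant_nb r v i \<noteq> v"
  proof
    assume "circulant_nb r v i = v"
    then have "(v + (if i < 9 then int i + 1 else 8 - int i)) mod r = (v + 0) mod r"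
      using v by (simp add: circulant_nb_def)
    from mod_shift_cancel[OF this] show False using i assms by (cases "i < 9") auto
  qed
qed (auto simp: opp_def)

text \<open>The coordinate \<open>a\<close> keeps the graph simple: the four kinds of ports shift it by \<open>1\<close>, \<open>2\<close>, \<open>- 1\<close>
  and \<open>- 2\<close>, and ports of the same kind differ by a translation. Its range \<open>q\<close> is free and adjusts
  the number of vertices.\<close>

definition margulis_nb :: "int \<Rightarrow> int \<Rightarrow> int \<times> int \<times> int \<Rightarrow> nat \<Rightarrow> int \<times> int \<times> int" where
  "margulis_nb m q = (\<lambda>(x, y, a) i.
     if i < 5 then ((x + 2 * y + int i) mod m, y, (a + 1) mod q)
     else if i < 9 then (x, (y + 2 * x + (int i - 5)) mod m, (a + 2) mod q)
     else if i < 14 then ((x - 2 * y + (9 - int i)) mod m, y, (a + - 1) mod q)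
     else (x, (y - 2 * x + (14 - int i)) mod m, (a + - 2) mod q))"

text \<open>Modulo q >= 5 the shifts 1, 2, -1, -2 of the last coordinate are distinct and nonzero,
  so they reveal the kind of the port. Within a kind the translations, at most five, are distinct
  modulo m >= 5.\<close>

lemma port_graph_margulis:
  assumes m: "m \<ge> 5" and q: "q \<ge> 5"
  shows "port_graph ({0..<m} \<times> {0..<m} \<times> {0..<q}) (margulis_nb m q) opp 18"
proof
  fix v assume "v \<in> {0..<m} \<times> {0..<m} \<times> {0..<q}"
  then obtain x y a where v: "v = (x, y, a)" "x \<in> {0..<m}" "y \<in> {0..<m}" "a \<in> {0..<q}" by auto
  define \<delta> :: "nat \<Rightarrow> int" where "\<delta> i = (if i < 5 then 1 else if i < 9 then 2 else if i < 14 then - 1 else - 2)" for i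
  have snd: "snd (snd (margulis_nb m q v i)) = (a + \<delta> i) mod q" for i
    by (simp add: margulis_nb_def v \<delta>_def)
  have \<delta>: "\<bar>\<delta> i - \<delta> j\<bar> < q" "\<bar>\<delta> i - 0\<bar> < q" "\<delta> i \<noteq> 0" for i j using q by (auto simp: \<delta>_def)
  have inj: "i = j" if eq: "margulis_nb m q v i = margulis_nb m q v j" and ij: "i < 18" "j < 18" for i j
  proof -
    have "\<delta> i = \<delta> j" using mod_shift_cancel[OF _ \<delta>(1)] snd[of i] snd[of j] eq by metis
    then consider "i < 5" "j < 5" | "5 \<le> i" "i < 9" "5 \<le> j" "j < 9"
      | "9 \<le> i" "i < 14" "9 \<le> j" "j < 14" | "14 \<le> i" "14 \<le> j"
      by (auto simp: \<delta>_def split: if_splits)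
    then show ?thesis
    proof cases
      case 1
      then have "(x + 2 * y + int i) mod m = (x + 2 * y + int j) mod m" using eq by (simp add: margulis_nb_def v)
      from mod_shift_cancel[OF this] show ?thesis using 1 m by simp
    next
      case 2
      then have "(y + 2 * x + (int i - 5)) mod m = (y + 2 * x + (int j - 5)) mod m"
        using eq by (simp add: margulis_nb_def v)
      from mod_shift_cancel[OF this] show ?thesis using 2 m by simp
    next
      case 3
      then have "(x - 2 * y + (9 - int i)) mod m = (x - 2 * y + (9 - int j)) mod m"
        using eq by (simp add: margulis_nb_def v)
      from mod_shift_cancel[OF this] show ?thesis using 3 m by simp
    next
      case 4
      then have "(y - 2 * x + (14 - int i)) mod m = (y - 2 * x + (14 - int j)) mod m"
        using eq by (simp add: margulis_nb_def v)
      from mod_shift_cancel[OF this] show ?thesis using 4 ij m by simp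
    qed
  qed
  then show "inj_on (margulis_nb m q v) {..<18}" by (auto simp: inj_on_def)
  fix i :: nat assume i: "i < 18"
  show "margulis_nb m q v i \<in> {0..<m} \<times> {0..<m} \<times> {0..<q}"
    using m q v by (simp add: margulis_nb_def)
  have shift_back: "((z + s) mod k + t) mod k = z" if "t = - s" "z \<in> {0..<k}" for z s t k :: int
    using that by (simp add: mod_simps)
  consider "i < 5" | "5 \<le> i" "i < 9" | "9 \<le> i" "i < 14" | "14 \<le> i" by linarith
  then show "margulis_nb m q (margulis_nb m q v i) (opp i) = v"
  proof cases
    case 1
    then show ?thesis
      using shift_back[of "- (2 * y + int i)" "2 * y + int i" x m] shift_back[of "- 1" 1 a q] v
      by (simp add: margulis_nb_def opp_def algebra_simps)
  next
    case 2
    then show ?thesis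
      using shift_back[of "- (2 * x + (int i - 5))" "2 * x + (int i - 5)" y m] shift_back[of "- 2" 2 a q] v
      by (simp add: margulis_nb_def opp_def algebra_simps)
  next
    case 3
    then show ?thesis
      using shift_back[of "2 * y - (9 - int i)" "- (2 * y) + (9 - int i)" x m] shift_back[of 1 "- 1" a q] v
      by (simp add: margulis_nb_def opp_def algebra_simps of_nat_diff)
  next
    case 4
    then have "\<not> i - 9 < 5" "i - 9 < 9" using i by auto
    then show ?thesis
      using 4 shift_back[of "2 * x - (14 - int i)" "- (2 * x) + (14 - int i)" y m] shift_back[of 2 "- 2" a q] v i
      by (simp add: margulis_nb_def opp_def algebra_simps of_nat_diff)
  qed
  show "margulis_nb m q v i \<noteq> v"
  proof
    assume "margulis_nb m q v i = v"
    then have "(a + \<delta> i) mod q = (a + 0) mod q" using snd[of i] v by simp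
    from mod_shift_cancel[OF this \<delta>(2)] show False using \<delta>(3) by simp
  qed
qed (auto simp: opp_def)

text \<open>For a colouring with values 1 and -1, the product along an edge is 1, or -1 if the edge
  is cut. Over ports 0, 1, 5, 6 \<open>gabber_galil\<close> thus allows (4 + 73/20) / 2 = 153/40 cut
  ports per vertex on average; the other 14 are counted as cut, and 153/40 + 14 = 713/40.\<close>

lemma margulis_max_cut:
  fixes f :: "int \<times> int \<times> int \<Rightarrow> bool"
  assumes m: "m \<ge> 5" and q: "q \<ge> 5"
  shows "real (card {(v, i) \<in> ({0..<m} \<times> {0..<m} \<times> {0..<q}) \<times> {..<18}. f v \<noteq> f (margulis_nb m q v i)})
    \<le> 713/40 * real_of_int (m\<^sup>2 * q)"
proof -
  let ?B = "{0..<m} \<times> {0..<m} \<times> {0..<q}"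
  define F :: "int \<Rightarrow> int \<Rightarrow> int \<Rightarrow> real" where
    "F a x y = (if f (x mod m, y mod m, a mod q) then 1 else - 1)" for a x y
  define c where "c v i = (of_bool (f v \<noteq> f (margulis_nb m q v i)) :: real)" for v i
  have total: "(\<Sum>v\<in>?B. g v) = (\<Sum>a\<in>{0..<q}. \<Sum>x\<in>{0..<m}. \<Sum>y\<in>{0..<m}. g (x, y, a))" for g :: "_ \<Rightarrow> real"
  proof -
    have "(\<Sum>v\<in>?B. g v) = (\<Sum>x\<in>{0..<m}. \<Sum>y\<in>{0..<m}. \<Sum>a\<in>{0..<q}. g (x, y, a))"
      by (simp add: sum.cartesian_product case_prod_unfold)
    also have "\<dots> = (\<Sum>x\<in>{0..<m}. \<Sum>a\<in>{0..<q}. \<Sum>y\<in>{0..<m}. g (x, y, a))"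
      by (rule sum.cong[OF refl], rule sum.swap)
    also have "\<dots> = (\<Sum>a\<in>{0..<q}. \<Sum>x\<in>{0..<m}. \<Sum>y\<in>{0..<m}. g (x, y, a))"
      by (rule sum.swap)
    finally show ?thesis .
  qed
  have card_B: "(\<Sum>a\<in>{0..<q}. \<Sum>x\<in>{0..<m}. \<Sum>y\<in>{0..<m}. (1::real)) = real_of_int (m\<^sup>2 * q)"
    using m q by (simp add: power2_eq_square)
  have F_sq: "(F a x y)\<^sup>2 = 1" for a x y by (simp add: F_def)
  have "- (73/20) * (\<Sum>a\<in>{0..<q}. \<Sum>x\<in>{0..<m}. \<Sum>y\<in>{0..<m}. (F a x y)\<^sup>2) \<le> (\<Sum>a\<in>{0..<q}. \<Sum>x\<in>{0..<m}. \<Sum>y\<in>{0..<m}. F a x y *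
      (F (a + 1) (x + 2 * y) y + F (a + 1) (x + 2 * y + 1) y
        + (F (a + 2) x (y + 2 * x) + F (a + 2) x (y + 2 * x + 1))))"
    using m q by (intro gabber_galil) (simp_all add: F_def)
  also have "\<dots> = (\<Sum>a\<in>{0..<q}. \<Sum>x\<in>{0..<m}. \<Sum>y\<in>{0..<m}.
      4 * 1 - 2 * (c (x, y, a) 0 + c (x, y, a) 1 + c (x, y, a) 5 + c (x, y, a) 6))"
    by (intro sum.cong refl) (auto simp: F_def c_def margulis_nb_def)
  also have "\<dots> = 4 * real_of_int (m\<^sup>2 * q) - 2 * (\<Sum>v\<in>?B. c v 0 + c v 1 + c v 5 + c v 6)"
    unfolding sum_subtractf sum_distrib_left[symmetric] card_B total ..
  finally have "- (73/20) * real_of_int (m\<^sup>2 * q)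
      \<le> 4 * real_of_int (m\<^sup>2 * q) - 2 * (\<Sum>v\<in>?B. c v 0 + c v 1 + c v 5 + c v 6)"
    by (simp only: F_sq card_B)
  then have four: "(\<Sum>v\<in>?B. c v 0 + c v 1 + c v 5 + c v 6) \<le> 153/40 * real_of_int (m\<^sup>2 * q)"
    by simp
  have "card {(v, i) \<in> ?B \<times> {..<18}. f v \<noteq> f (margulis_nb m q v i)} = (\<Sum>v\<in>?B. \<Sum>i<18. c v i)"
  proof -
    have "(\<Sum>v\<in>?B. \<Sum>i<18. c v i) = (\<Sum>x\<in>?B \<times> {..<18}. if f (fst x) \<noteq> f (margulis_nb m q (fst x) (snd x)) then 1 else 0)"
      unfolding c_def by (simp only: sum.cartesian_product case_prod_unfold of_bool_def)
    also have "\<dots> = real (card (?B \<times> {..<18} \<inter> {x. f (fst x) \<noteq> f (margulis_nb m q (fst x) (snd x))}))"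
      by (subst sum.If_cases) simp_all
    also have "?B \<times> {..<18} \<inter> {x. f (fst x) \<noteq> f (margulis_nb m q (fst x) (snd x))}
      = {(v, i) \<in> ?B \<times> {..<18}. f v \<noteq> f (margulis_nb m q v i)}"
      by auto
    finally show ?thesis by simp
  qed
  also have "\<dots> \<le> (\<Sum>v\<in>?B. c v 0 + c v 1 + c v 5 + c v 6 + 14)"
  proof (rule sum_mono)
    fix v
    have "(\<Sum>i<18. c v i) = (\<Sum>i\<in>{0,1,5,6}. c v i) + (\<Sum>i\<in>{..<18} - {0,1,5,6}. c v i)"
      by (rule sum.subset_diff[THEN trans[OF _ add.commute]]) auto
    also have "(\<Sum>i\<in>{..<18} - {0,1,5,6}. c v i) \<le> (\<Sum>i\<in>{..<18::nat} - {0,1,5,6}. 1)"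
      by (intro sum_mono) (simp add: c_def)
    also have "\<dots> = 14" by (simp add: card_Diff_subset)
    finally show "(\<Sum>i<18. c v i) \<le> c v 0 + c v 1 + c v 5 + c v 6 + 14" by simp
  qed
  also have "\<dots> = (\<Sum>v\<in>?B. c v 0 + c v 1 + c v 5 + c v 6) + 14 * real_of_int (m\<^sup>2 * q)"
    using m q by (simp add: sum.distrib power2_eq_square)
  finally show ?thesis using four by linarith
qed

section \<open>Short odd closed walks in the Margulis graph\<close>

text \<open>With e reduced modulo m and y in range, \<open>\<bar>k\<bar> * y - e\<close> lies
  strictly between -m and |k| m. If m divides it, the quotient is one of 0, ..., |k| - 1, and it
  determines y.\<close>

lemma card_linear_congruence_le:
  fixes k c m :: int
  assumes "m > 0" "k \<noteq> 0"
  shows "card {y \<in> {0..<m}. m dvd k * y + c} \<le> nat \<bar>k\<bar>"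
proof -
  define e where "e = (- (sgn k * c)) mod m"
  have e: "0 \<le> e" "e < m" using assms(1) by (simp_all add: e_def)
  have dvd: "m dvd \<bar>k\<bar> * y - e" if "m dvd k * y + c" for y
  proof -
    have eq: "\<bar>k\<bar> * y - e = sgn k * (k * y + c) + (- (sgn k * c) - e)"
      by (simp add: algebra_simps abs_sgn)
    have "m dvd - (sgn k * c) - e" unfolding e_def by (rule dvd_minus_mod)
    then show ?thesis unfolding eq by (rule dvd_add[OF dvd_mult[OF that]])
  qed
  let ?S = "{y \<in> {0..<m}. m dvd k * y + c}" and ?h = "\<lambda>y. (\<bar>k\<bar> * y - e) div m"
  have h: "?h y * m = \<bar>k\<bar> * y - e" if "y \<in> ?S" for y
    using dvd that by simp
  have "inj_on ?h ?S"
  proof (rule inj_onI)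
    fix y z assume "y \<in> ?S" "z \<in> ?S" "?h y = ?h z"
    then have "\<bar>k\<bar> * y - e = \<bar>k\<bar> * z - e" using h by metis
    then show "y = z" using assms(2) by simp
  qed
  moreover have "?h ` ?S \<subseteq> {0..<\<bar>k\<bar>}"
  proof
    fix j assume "j \<in> ?h ` ?S"
    then obtain y where y: "y \<in> ?S" "j = ?h y" by blast
    have "0 \<le> \<bar>k\<bar> * y" "\<bar>k\<bar> * y \<le> \<bar>k\<bar> * (m - 1)" using y by (auto intro: mult_left_mono)
    then have "- m < j * m" "j * m < \<bar>k\<bar> * m"
    proof -
      have "j * m = \<bar>k\<bar> * y - e" using h[OF y(1)] y(2) by simp
      moreover have "\<bar>k\<bar> * (m - 1) = \<bar>k\<bar> * m - \<bar>k\<bar>" by (simp add: algebra_simps)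
      moreover have "\<bar>k\<bar> > 0" using assms(2) by simp
      ultimately show "- m < j * m" "j * m < \<bar>k\<bar> * m"
        using e \<open>0 \<le> \<bar>k\<bar> * y\<close> \<open>\<bar>k\<bar> * y \<le> \<bar>k\<bar> * (m - 1)\<close> by linarith+
    qed
    then have "- 1 < j" "j < \<bar>k\<bar>"
      using mult_less_cancel_right_pos[OF assms(1), of "- 1" j] mult_less_cancel_right_pos[OF assms(1), of j "\<bar>k\<bar>"]
      by auto
    then show "j \<in> {0..<\<bar>k\<bar>}" by simp
  qed
  ultimately have "card ?S \<le> card {0..<\<bar>k\<bar>}" by (intro card_inj_on_le) auto
  then show ?thesis by simp
qed

text \<open>Modulo \<open>4\<close> the two shears are \<open>1 + 2 X\<close> with \<open>X\<close> an off-diagonal matrix unit, so the parity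
  of the number of shears is read off the off-diagonal entries of their product.\<close>

lemma margulis_walk_affine:
  assumes "m > 0" "set is \<subseteq> {..<18}"
  shows "\<exists>A B C D b c. odd A \<and> odd D \<and> (odd (B + C) \<longleftrightarrow> odd (length is)) \<and>
    \<bar>A\<bar> \<le> 3 ^ length is \<and> \<bar>2 * B\<bar> \<le> 3 ^ length is \<and> \<bar>2 * C\<bar> \<le> 3 ^ length is \<and> \<bar>D\<bar> \<le> 3 ^ length is \<and>
    (\<forall>x y a. \<exists>x' y' a'. foldl (margulis_nb m q) (x, y, a) is = (x', y', a') \<and>
      x' mod m = (A * x + 2 * B * y + b) mod m \<and> y' mod m = (2 * C * x + D * y + c) mod m)"
  using assms(2)
proof (induction "is" rule: rev_induct)
  case Nil
  show ?case
    by (rule exI[of _ 1], rule exI[of _ 0], rule exI[of _ 0], rule exI[of _ 1], rule exI[of _ 0],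
        rule exI[of _ 0]) simp
next
  case (snoc i "is")
  then have "set is \<subseteq> {..<18}" by simp
  from snoc.IH[OF this] obtain A B C D b c where IH: "odd A" "odd D" "odd (B + C) \<longleftrightarrow> odd (length is)"
      "\<bar>A\<bar> \<le> 3 ^ length is" "\<bar>2 * B\<bar> \<le> 3 ^ length is" "\<bar>2 * C\<bar> \<le> 3 ^ length is" "\<bar>D\<bar> \<le> 3 ^ length is"
    and w: "\<And>x y a. \<exists>x' y' a'. foldl (margulis_nb m q) (x, y, a) is = (x', y', a') \<and>
      x' mod m = (A * x + 2 * B * y + b) mod m \<and> y' mod m = (2 * C * x + D * y + c) mod m"
    by (elim exE conjE) (rule that, assumption+, blast)
  define k :: int where "k = (if i < 9 then 1 else - 1)"
  define l :: int where "l = (if i < 5 then int i else if i < 9 then int i - 5 else if i < 14 then 9 - int i else 14 - int i)"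
  have k: "k = 1 \<or> k = - 1" by (simp add: k_def)
  show ?case
  proof (cases "i < 5 \<or> (9 \<le> i \<and> i < 14)")
    case True
    then have nb: "\<exists>a'. margulis_nb m q (x, y, a) i = ((x + k * (2 * y) + l) mod m, y, a')" for x y a
      by (auto simp: margulis_nb_def k_def l_def)
    have *: "\<exists>x' y' a'. foldl (margulis_nb m q) (x, y, a) (is @ [i]) = (x', y', a') \<and>
      x' mod m = ((A + k * (4 * C)) * x + 2 * (B + k * D) * y + (b + k * (2 * c) + l)) mod m \<and>
      y' mod m = (2 * C * x + D * y + c) mod m" for x y a
    proof -
      obtain x' y' a' where x': "foldl (margulis_nb m q) (x, y, a) is = (x', y', a')"
        "x' mod m = (A * x + 2 * B * y + b) mod m" "y' mod m = (2 * C * x + D * y + c) mod m"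
        using w by blast
      have "(x' + k * (2 * y') + l) mod m
          = ((A * x + 2 * B * y + b) + k * (2 * (2 * C * x + D * y + c)) + l) mod m"
        by (intro mod_add_cong mod_mult_cong x' refl)
      then show ?thesis using nb[of x' y' a'] x' by (auto simp: algebra_simps)
    qed
    \<comment> \<open>Each new matrix entry is an old one plus or minus twice an entry bounded by
      \<open>3 ^ length is\<close>, whence the base 3. As D is odd, replacing B by B + k D flips the
      parity of B + C.\<close>
    have "odd (A + k * (4 * C))" "odd (B + k * D + C) \<longleftrightarrow> odd (length (is @ [i]))"
      "\<bar>A + k * (4 * C)\<bar> \<le> 3 ^ length (is @ [i])" "\<bar>2 * (B + k * D)\<bar> \<le> 3 ^ length (is @ [i])"
      "\<bar>2 * C\<bar> \<le> 3 ^ length (is @ [i])" "\<bar>D\<bar> \<le> 3 ^ length (is @ [i])"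
      using k IH by auto
    then show ?thesis using * IH(2) by blast
  next
    case False
    then have nb: "\<exists>a'. margulis_nb m q (x, y, a) i = (x, (y + k * (2 * x) + l) mod m, a')" for x y a
      by (auto simp: margulis_nb_def k_def l_def)
    have *: "\<exists>x' y' a'. foldl (margulis_nb m q) (x, y, a) (is @ [i]) = (x', y', a') \<and>
      x' mod m = (A * x + 2 * B * y + b) mod m \<and>
      y' mod m = (2 * (C + k * A) * x + (D + k * (4 * B)) * y + (c + k * (2 * b) + l)) mod m" for x y a
    proof -
      obtain x' y' a' where x': "foldl (margulis_nb m q) (x, y, a) is = (x', y', a')"
        "x' mod m = (A * x + 2 * B * y + b) mod m" "y' mod m = (2 * C * x + D * y + c) mod m"
        using w by blast
      have "(y' + k * (2 * x') + l) mod m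
          = ((2 * C * x + D * y + c) + k * (2 * (A * x + 2 * B * y + b)) + l) mod m"
        by (intro mod_add_cong mod_mult_cong x' refl)
      then show ?thesis using nb[of x' y' a'] x' by (auto simp: algebra_simps)
    qed
    have "odd (D + k * (4 * B))" "odd (B + (C + k * A)) \<longleftrightarrow> odd (length (is @ [i]))"
      "\<bar>D + k * (4 * B)\<bar> \<le> 3 ^ length (is @ [i])" "\<bar>2 * (C + k * A)\<bar> \<le> 3 ^ length (is @ [i])"
      "\<bar>2 * B\<bar> \<le> 3 ^ length (is @ [i])" "\<bar>A\<bar> \<le> 3 ^ length (is @ [i])"
      using k IH by auto
    then show ?thesis using * IH(1) by blast
  qed
qed

text \<open>The word acts as an affine map with off-diagonal entries 2 B and 2 C, and B + C is odd,
  so one of them is nonzero. The corresponding row of the fixed point equation is, for each value of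
  one coordinate, a congruence for the other with a nonzero coefficient of size at most
  \<open>3 ^ length is\<close>.\<close>

lemma card_fixed_points_le:
  assumes m: "m > 0" and "is": "set is \<subseteq> {..<18}" "odd (length is)"
  shows "card {(x, y). x \<in> {0..<m} \<and> y \<in> {0..<m} \<and> (\<exists>a. foldl (margulis_nb m q) (x, y, a) is = (x, y, a))}
    \<le> nat m * 3 ^ length is" (is "card ?S \<le> _")
proof -
  obtain A B C D b c where odd: "odd (B + C)"
    and bound: "\<bar>2 * B\<bar> \<le> 3 ^ length is" "\<bar>2 * C\<bar> \<le> 3 ^ length is"
    and w: "\<And>x y a. \<exists>x' y' a'. foldl (margulis_nb m q) (x, y, a) is = (x', y', a') \<and>
      x' mod m = (A * x + 2 * B * y + b) mod m \<and> y' mod m = (2 * C * x + D * y + c) mod m"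
    using margulis_walk_affine[OF m "is"(1), of q] "is"(2) by blast
  have fixed: "m dvd 2 * B * y + (A * x + b - x)" "m dvd 2 * C * x + (D * y + c - y)"
    if xy: "(x, y) \<in> ?S" for x y
  proof -
    obtain a where "foldl (margulis_nb m q) (x, y, a) is = (x, y, a)" using xy by auto
    then have "(A * x + 2 * B * y + b) mod m = x mod m" "(2 * C * x + D * y + c) mod m = y mod m"
      using w[of x y a] by auto
    then show "m dvd 2 * B * y + (A * x + b - x)" "m dvd 2 * C * x + (D * y + c - y)"
      by (simp_all add: mod_eq_dvd_iff algebra_simps)
  qed
  have fin: "finite (SIGMA z:{0..<m}. {u \<in> {0..<m}. m dvd k * u + g z})" for k and g :: "int \<Rightarrow> int"
    by (rule finite_subset[of _ "{0..<m} \<times> {0..<m}"]) auto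
  have count: "card (SIGMA z:{0..<m}. {u \<in> {0..<m}. m dvd k * u + g z}) \<le> nat m * 3 ^ length is"
    if "k \<noteq> 0" "\<bar>k\<bar> \<le> 3 ^ length is" for k and g :: "int \<Rightarrow> int"
  proof -
    have "nat \<bar>k\<bar> \<le> nat (3 ^ length is)" using that by (intro nat_mono)
    also have "\<dots> = 3 ^ length is" by (simp add: nat_power_eq)
    finally have "card {u \<in> {0..<m}. m dvd k * u + g z} \<le> 3 ^ length is" for z
      using card_linear_congruence_le[OF m that(1), of "g z"] by (rule order_trans[rotated])
    then have "(\<Sum>z\<in>{0..<m}. card {u \<in> {0..<m}. m dvd k * u + g z}) \<le> (\<Sum>z\<in>{0..<m}. 3 ^ length is)"
      by (rule sum_mono)
    moreover have "card (SIGMA z:{0..<m}. {u \<in> {0..<m}. m dvd k * u + g z})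
        = (\<Sum>z\<in>{0..<m}. card {u \<in> {0..<m}. m dvd k * u + g z})"
      by (rule card_SigmaI) (auto intro: finite_subset[of _ "{0..<m}"])
    ultimately show ?thesis by simp
  qed
  have "B \<noteq> 0 \<or> C \<noteq> 0" using odd by auto
  then show ?thesis
  proof
    assume "B \<noteq> 0"
    have "?S \<subseteq> (SIGMA x:{0..<m}. {y \<in> {0..<m}. m dvd 2 * B * y + (A * x + b - x)})"
      using fixed(1) by auto
    then have "card ?S \<le> card \<dots>" by (rule card_mono[OF fin])
    also have "\<dots> \<le> nat m * 3 ^ length is"
      using count[OF _ bound(1), of "\<lambda>x. A * x + b - x"] \<open>B \<noteq> 0\<close> by simp
    finally show ?thesis .
  next
    assume "C \<noteq> 0"
    have "?S \<subseteq> prod.swap ` (SIGMA y:{0..<m}. {x \<in> {0..<m}. m dvd 2 * C * x + (D * y + c - y)})"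
    proof
      fix z assume z: "z \<in> ?S"
      obtain x y where "z = (x, y)" by (cases z)
      then show "z \<in> prod.swap ` (SIGMA y:{0..<m}. {x \<in> {0..<m}. m dvd 2 * C * x + (D * y + c - y)})"
        using z fixed(2)[of x y] by (intro image_eqI[of _ _ "(y, x)"]) auto
    qed
    then have "card ?S \<le> card (prod.swap ` (SIGMA y:{0..<m}. {x \<in> {0..<m}. m dvd 2 * C * x + (D * y + c - y)}))"
      by (rule card_mono[OF finite_imageI[OF fin]])
    also have "\<dots> \<le> card (SIGMA y:{0..<m}. {x \<in> {0..<m}. m dvd 2 * C * x + (D * y + c - y)})"
      by (rule card_image_le[OF fin])
    also have "\<dots> \<le> nat m * 3 ^ length is"
      using count[OF _ bound(2), of "\<lambda>y. D * y + c - y"] \<open>C \<noteq> 0\<close> by simp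
    finally show ?thesis .
  qed
qed

text \<open>Union bound over at most 18^(R+1) words, each fixing at most m 3^(R+1) points of the
  torus, times q values of the last coordinate; hence 54 = 18 * 3.\<close>

lemma card_odd_closed_walks_le:
  assumes m: "m > 0" and q: "q > 0"
  shows "card {v \<in> {0..<m} \<times> {0..<m} \<times> {0..<q}. \<exists>is. set is \<subseteq> {..<18} \<and> length is \<le> R \<and>
      odd (length is) \<and> foldl (margulis_nb m q) v is = v} \<le> nat m * nat q * 54 ^ (R + 1)" (is "card ?Z \<le> _")
proof -
  let ?S = "\<lambda>is. {(x, y). x \<in> {0..<m} \<and> y \<in> {0..<m} \<and> (\<exists>a. foldl (margulis_nb m q) (x, y, a) is = (x, y, a))}"
  define L where "L = {is :: nat list. (set is \<subseteq> {..<18} \<and> length is \<le> R) \<and> odd (length is)}"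
  have fin: "finite {is :: nat list. set is \<subseteq> {..<18} \<and> length is \<le> R}"
    by (rule finite_lists_length_le) simp
  have finL: "finite L" unfolding L_def by (rule finite_subset[OF _ fin]) auto
  have finS: "finite (?S is)" for "is"
    by (rule finite_subset[of _ "{0..<m} \<times> {0..<m}"]) auto
  have "(\<Sum>i\<le>R. 18 ^ i) \<le> (18 :: nat) ^ (R + 1)"
    by (induction R) auto
  moreover have "card L \<le> card {is :: nat list. set is \<subseteq> {..<18} \<and> length is \<le> R}"
    unfolding L_def by (rule card_mono[OF fin]) auto
  ultimately have L: "card L \<le> 18 ^ (R + 1)"
    using card_lists_length_le[of "{..<18::nat}" R] by simp
  have "?Z \<subseteq> (\<lambda>((x, y), a). (x, y, a)) ` ((\<Union>is\<in>L. ?S is) \<times> {0..<q})"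
    by (force simp: L_def image_iff)
  then have "card ?Z \<le> card ((\<lambda>((x, y), a). (x, y, a)) ` ((\<Union>is\<in>L. ?S is) \<times> {0..<q}))"
    by (rule card_mono[rotated]) (use finL finS in auto)
  also have "\<dots> \<le> card ((\<Union>is\<in>L. ?S is) \<times> {0..<q})"
    by (rule card_image_le) (use finL finS in auto)
  also have "\<dots> = card (\<Union>is\<in>L. ?S is) * nat q"
    by (simp add: card_cartesian_product)
  also have "card (\<Union>is\<in>L. ?S is) \<le> (\<Sum>is\<in>L. card (?S is))"
    by (rule card_UN_le[OF finL])
  also have "\<dots> \<le> (\<Sum>is\<in>L. nat m * 3 ^ (R + 1))"
  proof (rule sum_mono)
    fix "is" assume "is \<in> L"
    then have "card (?S is) \<le> nat m * 3 ^ length is"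
      using card_fixed_points_le[OF m, of "is" q] by (simp add: L_def)
    also have "\<dots> \<le> nat m * 3 ^ (R + 1)"
      using \<open>is \<in> L\<close> by (intro mult_left_mono power_increasing) (auto simp: L_def)
    finally show "card (?S is) \<le> nat m * 3 ^ (R + 1)" .
  qed
  also have "\<dots> \<le> 18 ^ (R + 1) * (nat m * 3 ^ (R + 1))"
    using L by simp
  also have "\<dots> = nat m * 54 ^ (R + 1)"
    by (simp flip: power_mult_distrib)
  finally show ?thesis by (simp add: mult_ac)
qed

section \<open>The lower bound\<close>

lemma card_edges_eq_of_side:
  assumes "simple_graph V E" "regular d V E" "S \<subseteq> V"
    and side: "\<And>e. e \<in> E \<Longrightarrow> \<exists>s\<in>S. \<exists>t. t \<notin> S \<and> e = {s, t}"
  shows "card E = d * card S"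
proof -
  have finV: "finite V" and E: "E \<subseteq> Pow V" using assms(1) by (auto simp: simple_graph_def)
  have finE: "finite E" using finite_subset[OF E] finV by simp
  let ?I = "\<lambda>s. {e \<in> E. s \<in> e}"
  have "E = (\<Union>s\<in>S. ?I s)" using side by blast
  also have "card \<dots> = (\<Sum>s\<in>S. card (?I s))"
  proof (rule card_UN_disjoint)
    show "finite S" using assms(3) finV by (rule finite_subset)
    show "\<forall>s\<in>S. finite (?I s)" using finE by simp
    show "\<forall>s\<in>S. \<forall>t\<in>S. s \<noteq> t \<longrightarrow> ?I s \<inter> ?I t = {}"
    proof (intro ballI impI equals0I)
      fix s t e assume st: "s \<in> S" "t \<in> S" "s \<noteq> t" and "e \<in> ?I s \<inter> ?I t"
      then obtain u w where "u \<in> S" "w \<notin> S" "e = {u, w}" "s \<in> e" "t \<in> e" using side by blast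
      then show False using st by blast
    qed
  qed
  also have "\<dots> = (\<Sum>s\<in>S. d)"
  proof (rule sum.cong[OF refl])
    fix s assume s: "s \<in> S"
    have "?I s = (\<lambda>u. {u, s}) ` neighbours E s"
    proof (intro equalityI subsetI)
      fix e assume e: "e \<in> ?I s"
      then obtain u w where "e = {u, w}" using side by blast
      then have "e = {u, s} \<or> e = {w, s}" using e by blast
      then show "e \<in> (\<lambda>u. {u, s}) ` neighbours E s" using e by (auto simp: neighbours_def)
    qed (auto simp: neighbours_def)
    moreover have "inj_on (\<lambda>u. {u, s}) (neighbours E s)"
      by (auto simp: inj_on_def doubleton_eq_iff)
    ultimately have "card (?I s) = vertex_degree E s"
      by (simp add: card_image vertex_degree_def)
    then show "card (?I s) = d" using s assms(2,3) by (auto simp: regular_def)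
  qed
  finally show ?thesis by simp
qed

text \<open>Each edge has one end on either side, so both sides have |E| / d vertices. Doubles have
  even size, and the bound must reach every admissible size.\<close>

lemma even_regular_bipartite_sizes:
  assumes "n \<in> regular_bipartite_sizes d" "d > 0"
  shows "even n"
proof -
  obtain V E where VE: "simple_graph V E" "regular d V E" "bipartite V E" and n: "n = card V"
    using assms(1) by (auto simp: regular_bipartite_sizes_def)
  from VE(3) obtain S T where ST: "S \<union> T = V" "S \<inter> T = {}" "\<forall>e\<in>E. \<exists>s\<in>S. \<exists>t\<in>T. e = {s, t}"
    unfolding bipartite_def by (elim exE conjE) (rule that)
  have "card E = d * card S"
  proof (rule card_edges_eq_of_side[OF VE(1,2)])
    fix e assume "e \<in> E"
    with ST(3) obtain s t where st: "s \<in> S" "t \<in> T" "e = {s, t}" by blast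
    then have "t \<notin> S" using ST(2) by auto
    with st show "\<exists>s\<in>S. \<exists>t. t \<notin> S \<and> e = {s, t}" by blast
  qed (use ST(1) in blast)
  moreover have "card E = d * card T"
  proof (rule card_edges_eq_of_side[OF VE(1,2)])
    fix e assume "e \<in> E"
    with ST(3) obtain s t where st: "s \<in> S" "t \<in> T" "e = {s, t}" by blast
    then have "s \<notin> T" "e = {t, s}" using ST(2) by auto
    with st show "\<exists>s\<in>T. \<exists>t. t \<notin> T \<and> e = {s, t}" by blast
  qed (use ST(1) in blast)
  ultimately have "card S = card T" using assms(2) by simp
  moreover have "card V = card S + card T"
  proof -
    have "finite S" "finite T" using VE(1) ST(1) by (auto simp: simple_graph_def)
    then show ?thesis using ST(1,2) card_Un_disjoint[of S T] by simp
  qed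
  ultimately show ?thesis by (simp add: n)
qed

lemma foldl_case_sum_Inl:
  "foldl (case_sum (\<lambda>v i. Inl (f v i)) g) (Inl v) is = Inl (foldl f v is)"
  by (induction "is" arbitrary: v) simp_all

text \<open>Since 54^(R+1) = m / 2000, at most 1/2000 of the Margulis part is bad. The circulant
  part, at most 1/1000 of all vertices, is counted as bad and as entirely cut: the bad fraction is
  at most 0.0015, and the cut density 713/720 grows only slightly.\<close>

lemma base_graph:
  fixes N R :: nat
  defines "m \<equiv> 2000 * 54 ^ (R + 1) :: int"
  assumes N: "int N \<ge> 1000 * (m\<^sup>2 + 19)"
  obtains V :: "(int \<times> int \<times> int + int) set" and nb where "port_graph V nb opp 18" "card V = N"
    "\<And>f :: _ \<Rightarrow> bool. real (card {(v, i) \<in> V \<times> {..<18}. f v \<noteq> f (nb v i)}) \<le> 0.991 * (18 * real N)"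
    "real (card {v \<in> V. \<not> port_graph.no_odd_closed_walk nb 18 R v}) \<le> 0.002 * real N"
proof -
  \<comment> \<open>This leaves between 19 and m^2 + 18 vertices for the circulant graph, which
    needs 19 to have degree 18.\<close>
  define q where "q = (int N - 19) div m\<^sup>2"
  define r where "r = int N - m\<^sup>2 * q"
  have m: "m \<ge> 2000" using one_le_power[of "54::int" "R + 1"] by (simp add: m_def)
  have msq: "m\<^sup>2 > 0" using m by simp
  have r_eq: "r = 19 + (int N - 19) mod m\<^sup>2"
    by (simp add: r_def q_def minus_mult_div_eq_mod[symmetric])
  have r: "19 \<le> r" "1000 * r \<le> int N"
  proof -
    have "0 \<le> (int N - 19) mod m\<^sup>2" "(int N - 19) mod m\<^sup>2 < m\<^sup>2"
      using msq by simp_all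
    then show "19 \<le> r" "1000 * r \<le> int N" using r_eq N by simp_all
  qed
  have "5 * m\<^sup>2 \<le> int N - 19" using N msq by simp
  then have "5 * m\<^sup>2 div m\<^sup>2 \<le> q" unfolding q_def using msq by (rule zdiv_mono1)
  then have q: "q \<ge> 5" using msq by simp
  let ?B = "{0..<m} \<times> {0..<m} \<times> {0..<q}"
  define V where "V = ?B <+> {0..<r}"
  define nb where "nb = case_sum (\<lambda>v i. Inl (margulis_nb m q v i)) (\<lambda>v i. Inr (circulant_nb r v i) :: int \<times> int \<times> int + int)"
  interpret X: port_graph V nb opp 18
    unfolding V_def nb_def
    by (rule port_graph_Plus[OF port_graph_margulis port_graph_circulant]) (use m q r in simp_all)
  have Nr: "real N = real_of_int (m\<^sup>2 * q) + real_of_int r"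
  proof -
    have "real_of_int (int N) = real_of_int (m\<^sup>2 * q + r)" by (simp only: r_def add_diff_eq add_diff_cancel_left')
    then show ?thesis by (simp only: of_int_add of_int_of_nat_eq)
  qed
  have rN: "1000 * real_of_int r \<le> real N"
    using r(2) by (metis of_int_le_iff of_int_mult of_int_numeral of_int_of_nat_eq)
  have card: "card V = N"
  proof -
    have "card V = nat m * (nat m * nat q) + nat r"
      by (simp add: V_def card_Plus card_cartesian_product)
    also have "int \<dots> = int N"
      using m q r by (simp add: r_def power2_eq_square)
    finally show ?thesis by simp
  qed
  have cut: "real (card {(v, i) \<in> V \<times> {..<18}. f v \<noteq> f (nb v i)}) \<le> 0.991 * (18 * real N)"
    for f :: "_ \<Rightarrow> bool"
  proof -
    let ?g = "\<lambda>v. f (Inl v)"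
    let ?C = "{(v, i) \<in> ?B \<times> {..<18}. ?g v \<noteq> ?g (margulis_nb m q v i)}"
    let ?I = "(\<lambda>(v, i). (Inl v :: int \<times> int \<times> int + int, i)) ` ?C"
    let ?J = "(\<lambda>(v, i). (Inr v :: int \<times> int \<times> int + int, i)) ` ({0..<r} \<times> {..<18::nat})"
    have finC: "finite ?C" by (rule finite_subset[of _ "?B \<times> {..<18}"]) auto
    have "{(v, i) \<in> V \<times> {..<18}. f v \<noteq> f (nb v i)}
        \<subseteq> ?I \<union> ?J"
      by (auto simp: V_def nb_def image_iff)
    then have "card {(v, i) \<in> V \<times> {..<18}. f v \<noteq> f (nb v i)}
        \<le> card (?I \<union> ?J)"
      using finC by (intro card_mono) auto
    also have "\<dots> \<le> card ?I + card (?J)"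
      by (rule card_Un_le)
    also have "\<dots> \<le> card ?C + card ({0..<r} \<times> {..<18::nat})"
      using finC by (intro add_mono card_image_le) auto
    also have "card ({0..<r} \<times> {..<18::nat}) = 18 * nat r"
      by (simp add: card_cartesian_product)
    finally have "real (card {(v, i) \<in> V \<times> {..<18}. f v \<noteq> f (nb v i)}) \<le> real (card ?C + 18 * nat r)"
      by (rule of_nat_mono)
    also have "\<dots> = real (card ?C) + 18 * real_of_int r"
      using r by simp
    finally have "real (card {(v, i) \<in> V \<times> {..<18}. f v \<noteq> f (nb v i)}) \<le> real (card ?C) + 18 * real_of_int r" .
    moreover have "real (card ?C) \<le> 713/40 * real_of_int (m\<^sup>2 * q)"
      using m q by (intro margulis_max_cut) auto
    ultimately show ?thesis using Nr rN by simp
  qed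
  have bad: "real (card {v \<in> V. \<not> X.no_odd_closed_walk R v}) \<le> 0.002 * real N"
  proof -
    let ?Z = "{v \<in> ?B. \<exists>is. set is \<subseteq> {..<18} \<and> length is \<le> R \<and> odd (length is) \<and> foldl (margulis_nb m q) v is = v}"
    let ?I = "Inl ` ?Z :: (int \<times> int \<times> int + int) set" and ?J = "Inr ` {0..<r} :: (int \<times> int \<times> int + int) set"
    have walk: "foldl nb (Inl v) is = Inl (foldl (margulis_nb m q) v is)" for v "is"
      unfolding nb_def by (rule foldl_case_sum_Inl)
    have finZ: "finite ?Z" by (rule finite_subset[of _ ?B]) auto
    have "{v \<in> V. \<not> X.no_odd_closed_walk R v} \<subseteq> ?I \<union> ?J"
      unfolding X.no_odd_closed_walk_def X.walk_def by (auto simp: walk V_def image_iff) blast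
    then have "card {v \<in> V. \<not> X.no_odd_closed_walk R v} \<le> card (?I \<union> ?J)"
      by (rule card_mono[rotated]) (intro finite_UnI finite_imageI finZ finite_atLeastLessThan_int)
    also have "\<dots> \<le> card ?I + card ?J"
      by (rule card_Un_le)
    also have "\<dots> \<le> card ?Z + card {0..<r}"
      by (intro add_mono card_image_le finZ finite_atLeastLessThan_int)
    also have "\<dots> \<le> nat m * nat q * 54 ^ (R + 1) + nat r"
      using card_odd_closed_walks_le[of m q R] m q by simp
    finally have "real (card {v \<in> V. \<not> X.no_odd_closed_walk R v}) \<le> real (nat m * nat q * 54 ^ (R + 1) + nat r)"
      by (rule of_nat_mono)
    also have "\<dots> = real_of_int m * real_of_int q * 54 ^ (R + 1) + real_of_int r"
      using m q r by simp
    also have "real_of_int m * real_of_int q * 54 ^ (R + 1) = real_of_int (m\<^sup>2 * q) / 2000"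
      by (simp add: m_def power2_eq_square)
    finally show ?thesis using Nr rN r by simp
  qed
  show ?thesis by (rule that[OF X.port_graph_axioms card cut bad])
qed

text \<open>By contradiction: if N were at least 1000 (m^2 + 19), the base graph would exist for the
  radius R that the rounds of A require, and \<open>cut_density_le_max_cut\<close> would give 0.999
  - 0.002 <= 0.991.\<close>

lemma size_le_exp_rounds:
  fixes A :: "('s, 'm) local_algorithm"
  assumes cut: "\<And>V E P. simple_graph V E \<Longrightarrow> regular 18 V E \<Longrightarrow> port_numbering V E P \<Longrightarrow>
      computes_cut A V E P"
    and approx: "\<And>V E P. simple_graph V E \<Longrightarrow> regular 18 V E \<Longrightarrow> bipartite V E \<Longrightarrow>
      port_numbering V E P \<Longrightarrow> expected_output_size A V E P \<ge> 0.999 * real (card E)"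
    and n: "n \<in> regular_bipartite_sizes 18"
  shows "real n \<le> (2000 * 2000 * 2000 * 20 * 54 ^ 6) * (54 ^ 4) ^ rounds A n"
proof -
  define N where "N = n div 2"
  have nN: "n = 2 * N" using even_regular_bipartite_sizes[OF n] by (simp add: N_def)
  define R where "R = 2 * (rounds A (2 * N) + 1)"
  define m :: int where "m = 2000 * 54 ^ (R + 1)"
  have "\<not> int N \<ge> 1000 * (m\<^sup>2 + 19)"
  proof
    assume "int N \<ge> 1000 * (m\<^sup>2 + 19)"
    then obtain V :: "(int \<times> int \<times> int + int) set" and nb where X: "port_graph V nb opp 18"
      and card: "card V = N"
      and max_cut: "\<And>f :: _ \<Rightarrow> bool. real (card {(v, i) \<in> V \<times> {..<18}. f v \<noteq> f (nb v i)}) \<le> 0.991 * (18 * real N)"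
      and bad: "real (card {v \<in> V. \<not> port_graph.no_odd_closed_walk nb 18 R v}) \<le> 0.002 * real N"
      unfolding m_def by (rule base_graph) (rule that)
    interpret X: port_graph V nb opp 18 by (rule X)
    have "0 < 1000 * (m\<^sup>2 + 19)" by (simp add: add_nonneg_pos)
    then have "N > 0" using \<open>int N \<ge> 1000 * (m\<^sup>2 + 19)\<close> by simp
    have dbl: "port_graph (V \<times> UNIV) (X.dbl \<tau>) opp 18" for \<tau> by (rule X.port_graph_dbl)
    have "(0.999 :: real) - 0.002 \<le> 0.991"
    proof (rule X.cut_density_le_max_cut[where A = A])
      show "computes_cut A (port_graph.verts (V \<times> (UNIV :: bool set))) (port_graph.edges (V \<times> UNIV) (X.dbl \<tau>) 18)
        (port_graph.ports (X.dbl \<tau>))" for \<tau>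
        by (intro cut port_graph.simple[OF dbl] port_graph.regular[OF dbl] port_graph.port_numbering[OF dbl])
      show "0.999 * real (card (port_graph.edges (V \<times> UNIV) (X.dbl True) 18))
        \<le> expected_output_size A (port_graph.verts (V \<times> (UNIV :: bool set))) (port_graph.edges (V \<times> UNIV) (X.dbl True) 18)
          (port_graph.ports (X.dbl True))"
        by (intro approx port_graph.simple[OF dbl] port_graph.regular[OF dbl]
            port_graph.port_numbering[OF dbl] X.bipartite_dbl_True)
    qed (use max_cut bad card \<open>N > 0\<close> in \<open>auto simp: R_def\<close>)
    then show False by simp
  qed
  then have "int N < 1000 * m\<^sup>2 + 19000" by simp
  moreover have "m\<^sup>2 \<ge> 1"
  proof -
    have "m\<^sup>2 > 0" by (simp add: m_def)
    then show ?thesis by linarith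
  qed
  moreover have "int n = 2 * int N" by (simp add: nN)
  \<comment> \<open>n = 2 N < 2000 m^2 + 38000, and m^2 >= 1 absorbs the constant.\<close>
  ultimately have "int n \<le> 2000 * 20 * m\<^sup>2" by linarith
  then have "real_of_int (int n) \<le> real_of_int (2000 * 20 * m\<^sup>2)" by (simp only: of_int_le_iff)
  also have "\<dots> = (2000 * 2000 * 2000 * 20) * (54 ^ (R + 1) * 54 ^ (R + 1))"
    by (simp add: m_def power2_eq_square)
  also have "(54 ^ (R + 1) * 54 ^ (R + 1) :: real) = 54 ^ (6 + 4 * rounds A n)"
  proof -
    \<comment> \<open>For T rounds R + 1 = 2 T + 3, and the square of m doubles this
      exponent.\<close>
    have "R + 1 + (R + 1) = 6 + 4 * rounds A n" by (simp add: R_def nN)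
    then show ?thesis by (simp only: power_add[symmetric])
  qed
  also have "\<dots> = 54 ^ 6 * (54 ^ 4) ^ rounds A n"
    by (simp only: power_add power_mult)
  finally show ?thesis by (simp only: of_int_of_nat_eq mult.assoc)
qed

theorem theoremB7:
  fixes A :: "('s, 'm) local_algorithm"
  assumes cut: "\<And>V E P. simple_graph V E \<Longrightarrow> regular 18 V E \<Longrightarrow> port_numbering V E P \<Longrightarrow>
      computes_cut A V E P"
    and approx: "\<And>V E P. simple_graph V E \<Longrightarrow> regular 18 V E \<Longrightarrow> bipartite V E \<Longrightarrow>
      port_numbering V E P \<Longrightarrow> expected_output_size A V E P \<ge> 0.999 * real (card E)"
  shows "(\<lambda>n. real (rounds A n)) \<in>
      \<Omega>[inf sequentially (principal (regular_bipartite_sizes 18))](\<lambda>n. ln (real n))"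
proof -
  define C K :: real where "C = 2000 * 2000 * 2000 * 20 * 54 ^ 6" and "K = 54 ^ 4"
  have CK: "C > 1" "K > 1" by (simp_all add: C_def K_def)
  \<comment> \<open>From n >= C^2 on, the constant C costs at most half of ln n, whence the 2 in the
    denominator.\<close>
  have bound: "1 / (2 * ln K) * ln (real n) \<le> real (rounds A n)"
    if n: "n \<in> regular_bipartite_sizes 18" "real n \<ge> C\<^sup>2" for n
  proof -
    have "C\<^sup>2 > 0" using CK by simp
    then have "real n > 0" using n(2) by linarith
    moreover have "real n \<le> C * K ^ rounds A n"
      using size_le_exp_rounds[OF cut approx n(1)] by (simp only: C_def K_def)
    ultimately have "ln (real n) \<le> ln (C * K ^ rounds A n)" using CK by simp
    also have "\<dots> = ln C + real (rounds A n) * ln K" using CK by (simp add: ln_mult ln_realpow)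
    finally have "ln (real n) \<le> ln C + real (rounds A n) * ln K" .
    moreover have "2 * ln C \<le> ln (real n)"
    proof -
      have "ln (C\<^sup>2) \<le> ln (real n)" using n(2) \<open>C\<^sup>2 > 0\<close> \<open>real n > 0\<close> by (subst ln_le_cancel_iff)
      then show ?thesis using CK by (simp add: ln_realpow)
    qed
    ultimately have "ln (real n) \<le> 2 * (real (rounds A n) * ln K)" by simp
    then show ?thesis using CK by (simp add: field_simps)
  qed
  have "eventually (\<lambda>n. real n \<ge> C\<^sup>2) sequentially"
    using filterlim_real_sequentially by (simp add: filterlim_at_top)
  then have "eventually (\<lambda>n. n \<in> regular_bipartite_sizes 18 \<longrightarrow>
      norm (real (rounds A n)) \<ge> 1 / (2 * ln K) * norm (ln (real n))) sequentially"
  proof eventually_elim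
    case (elim n)
    have "C\<^sup>2 \<ge> 1" using CK by simp
    then have "ln (real n) \<ge> 0" using elim by simp
    then show ?case using bound elim by simp
  qed
  then show ?thesis
    using CK by (intro landau_omega.bigI[of "1 / (2 * ln K)"]) (simp_all add: eventually_inf_principal)
qed

end
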